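(* Let $\mathcal{G}=(V,\mathcal{B},E)$ be a bounded degree Borel graph. Then every vertex of $\mathcal{G}$ has even degree if and only if $\mathcal{G}$ admits approximate balanced orientation. Moreover, if every vertex of $\mathcal{G}$ has even degree, then there is a sequence $\{S_n\}_{n\in\mathbb{N}}$ of orientations of $\mathcal{G}$ such that $$\mu\left(\left\{v\in \mathbf{Corr}(S_n): N_0(v)\subseteq \mathbf{Corr}(S_n)\right\}\right)\to 1 \quad (n\to\infty)$$ for every Borel probability measure $\mu$ on $(V,\mathcal{B})$.
   Context: A Borel graph is a triple $\mathcal{G}=(V,\mathcal{B},E)$ where $(V,\mathcal{B})$ is a standard Borel space and $E\subseteq V\times V$ is a Borel, symmetric, irreflexive set (the edges). $\Delta(\mathcal{G})$ denotes the maximum degree; $\mathcal{G}$ has bounded degree if $\Delta(\mathcal{G})\in\mathbb{N}$. $N_0(v)$ is the set of neighbors of $v$. An orientation of $\mathcal{G}$ is a Borel set $S\subseteq E$ such that for every edge $\{x,y\}$ exactly one of $(x,y),(y,x)$ lies in $S$. Put $\operatorname{out}_S(v)=\{(v,x)\in S\}$, $\operatorname{in}_S(v)=\{(x,v)\in S\}$ and $\mathbf{Corr}(S)=\{v\in V:|\operatorname{in}_S(v)|=|\operatorname{out}_S(v)|\}$. $\mathcal{G}$ admits approximate balanced orientation if for every Borel probability measure $\mu$ on $(V,\mathcal{B})$ and every $\epsilon>0$ there is an orientation $S$ of $\mathcal{G}$ with $\mu(\mathbf{Corr}(S))>1-\epsilon$. *)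

theory Defs
  imports "HOL-Probability.Probability"
begin

definition standard_borel :: "'a measure \<Rightarrow> bool" where
  "standard_borel M \<longleftrightarrow>
     (\<exists>X :: 'a topology. topspace X = space M \<and> completely_metrizable_space X \<and>
        separable_space X \<and> sets M = sigma_sets (space M) {U. openin X U})"

definition borel_graph :: "'a measure \<Rightarrow> ('a \<times> 'a) set \<Rightarrow> bool" where
  "borel_graph M E \<longleftrightarrow> standard_borel M \<and> E \<subseteq> space M \<times> space M \<and>
     E \<in> sets (M \<Otimes>\<^sub>M M) \<and> sym E \<and> irrefl E"

definition nbhd :: "('a \<times> 'a) set \<Rightarrow> 'a \<Rightarrow> 'a set" where
  "nbhd E v = {u. (v, u) \<in> E}"

definition bounded_degree :: "'a measure \<Rightarrow> ('a \<times> 'a) set \<Rightarrow> bool" where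
  "bounded_degree M E \<longleftrightarrow> (\<exists>d::nat. \<forall>v\<in>space M. finite (nbhd E v) \<and> card (nbhd E v) \<le> d)"

definition orientation :: "'a measure \<Rightarrow> ('a \<times> 'a) set \<Rightarrow> ('a \<times> 'a) set \<Rightarrow> bool" where
  "orientation M E S \<longleftrightarrow> S \<in> sets (M \<Otimes>\<^sub>M M) \<and> S \<subseteq> E \<and>
     (\<forall>x y. (x, y) \<in> E \<longrightarrow> ((x, y) \<in> S \<longleftrightarrow> (y, x) \<notin> S))"

definition out_edges :: "('a \<times> 'a) set \<Rightarrow> 'a \<Rightarrow> ('a \<times> 'a) set" where
  "out_edges S v = {p \<in> S. fst p = v}"

definition in_edges :: "('a \<times> 'a) set \<Rightarrow> 'a \<Rightarrow> ('a \<times> 'a) set" where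
  "in_edges S v = {p \<in> S. snd p = v}"

definition Corr :: "'a measure \<Rightarrow> ('a \<times> 'a) set \<Rightarrow> 'a set" where
  "Corr M S = {v \<in> space M. card (in_edges S v) = card (out_edges S v)}"

definition approx_balanced_orientation :: "'a measure \<Rightarrow> ('a \<times> 'a) set \<Rightarrow> bool" where
  "approx_balanced_orientation M E \<longleftrightarrow>
     (\<forall>\<mu> :: 'a measure. prob_space \<mu> \<and> sets \<mu> = sets M \<longrightarrow>
        (\<forall>\<epsilon>::real. \<epsilon> > 0 \<longrightarrow>
           (\<exists>S. orientation M E S \<and> measure \<mu> (Corr M S) > 1 - \<epsilon>)))"

end

(*
Proof idea. By Lusin's separation theorem the neighbourhoods of a Borel graph with finite degrees can be
enumerated by Borel functions. If all degrees are even, the neighbours of every vertex can therefore be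
paired in a Borel way, which splits the edges into walks: after entering y from x one leaves y to the
partner of x. Orienting a walk consistently balances the vertices it passes through. Let J be an injective
bounded Borel function on the directed edges, and compare the liminf of J along the two directions
of a walk. If they differ, orient the walk towards the smaller one. If they agree, cut the walk at the
edges whose J-value is different from the common liminf but within 1/n of it; every piece then has at
least one end, and is oriented by comparing the J-values of its ends. A given edge is a cut for only
finitely many n, so that every vertex is eventually balanced, and dominated convergence applies to
every probability measure. The converse follows by applying the hypothesis to Dirac measures.
*)

theory Submission
  imports Defs
begin

section \<open>Projections of closed sets and Lusin separation\<close>

text \<open>In a Polish space these are the analytic sets. The parameter space
  \<open>nat \<Rightarrow> real\<close> is Polish in the product topology, and one parameter can
  store countably many witnesses.\<close>

definition proj_closed :: "'a::topological_space set \<Rightarrow> bool" where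
  "proj_closed B \<longleftrightarrow> (\<exists>C :: ('a \<times> (nat \<Rightarrow> real)) set. closed C \<and> B = fst ` C)"

lemma proj_closedI:
  assumes "closed C" and "\<And>x. x \<in> B \<longleftrightarrow> (\<exists>\<alpha> :: nat \<Rightarrow> real. (x, \<alpha>) \<in> C)"
  shows "proj_closed B"
  unfolding proj_closed_def using assms by (intro exI[of _ C]) force

lemma proj_closedE:
  assumes "proj_closed B"
  obtains C where "closed C" "\<And>x. x \<in> B \<longleftrightarrow> (\<exists>\<alpha> :: nat \<Rightarrow> real. (x, \<alpha>) \<in> C)"
  using assms unfolding proj_closed_def by force

lemma continuous_on_coord: "continuous_on UNIV (\<lambda>p :: 'a::topological_space \<times> (nat \<Rightarrow> real). snd p i)"
  using continuous_on_compose2[OF continuous_on_product_coordinates[of i] continuous_on_snd[OF continuous_on_id]]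
  by auto

lemma continuous_on_reindex:
  "continuous_on UNIV (\<lambda>p :: 'a::topological_space \<times> (nat \<Rightarrow> real). (fst p, \<lambda>k. snd p (h k)))"
  by (intro continuous_on_Pair continuous_on_fst continuous_on_id continuous_on_coordinatewise_then_product
      continuous_on_coord)

lemma proj_closed_closed: "closed A \<Longrightarrow> proj_closed (A :: 'a::topological_space set)"
  by (rule proj_closedI[of "A \<times> UNIV"]) (auto intro: closed_Times)

text \<open>The parameter stores in coordinate 0 the reciprocal of the distance to the complement;
  this turns an open condition on \<open>x\<close> into a closed equation.\<close>

lemma proj_closed_open:
  assumes "open (A :: 'a::metric_space set)"
  shows "proj_closed A"
\<comment> \<open>The distance to the empty set is 0 by convention, so for \<open>A = UNIV\<close>
  the equation in \<open>?C\<close> would have no solution.\<close>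
proof (cases "A = UNIV")
  case False
  let ?C = "{p :: 'a \<times> (nat \<Rightarrow> real). snd p 0 * infdist (fst p) (- A) = 1}"
  show ?thesis
  proof (rule proj_closedI)
    show "closed ?C"
      by (intro closed_Collect_eq continuous_on_mult continuous_on_coord continuous_on_infdist
          continuous_on_fst continuous_on_id continuous_on_const)
    fix x
    have "x \<in> A \<longleftrightarrow> infdist x (- A) \<noteq> 0"
      using in_closed_iff_infdist_zero[of "- A" x] False assms by auto
    also have "\<dots> \<longleftrightarrow> (\<exists>\<alpha>::nat \<Rightarrow> real. \<alpha> 0 * infdist x (- A) = 1)"
      by (auto intro!: exI[of _ "\<lambda>_. 1 / infdist x (- A)"])
    finally show "x \<in> A \<longleftrightarrow> (\<exists>\<alpha>. (x, \<alpha>) \<in> ?C)"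
      unfolding mem_Collect_eq fst_conv snd_conv .
  qed
qed (simp add: proj_closed_closed)

text \<open>Coordinate 0 of the parameter names an index \<open>n\<close>, and the remaining
  coordinates form a witness for \<open>A n\<close>.\<close>

lemma proj_closed_UN:
  fixes A :: "nat \<Rightarrow> 'a::topological_space set"
  assumes "\<And>n. proj_closed (A n)"
  shows "proj_closed (\<Union>n. A n)"
proof -
  have "\<forall>n. \<exists>C. closed C \<and> (\<forall>x. x \<in> A n \<longleftrightarrow> (\<exists>\<alpha> :: nat \<Rightarrow> real. (x, \<alpha>) \<in> C))"
    using assms by (metis proj_closedE)
  then obtain C where C: "\<And>n. closed (C n)"
    and A: "\<And>n x. x \<in> A n \<longleftrightarrow> (\<exists>\<alpha> :: nat \<Rightarrow> real. (x, \<alpha>) \<in> C n)"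
    by metis
  \<comment> \<open>Distinct naturals are at distance at least 1, so the last inequality is a closed
    way of saying that the stored index is not \<open>n\<close>.\<close>
  let ?D = "{p :: 'a \<times> (nat \<Rightarrow> real). snd p 0 \<in> \<nat> \<and>
     (\<forall>n. (fst p, \<lambda>k. snd p (Suc k)) \<in> C n \<or> 1 \<le> \<bar>snd p 0 - real n\<bar>)}"
  show ?thesis
  proof (rule proj_closedI)
    show "closed ?D"
      using closed_vimage[OF closed_Nats continuous_on_coord[where 'a='a, of 0]]
        closed_vimage[OF C continuous_on_reindex[where 'a='a, of Suc]]
      by (intro closed_Collect_conj closed_Collect_all closed_Collect_disj closed_Collect_le
          continuous_on_const continuous_on_rabs continuous_on_diff continuous_on_coord)
        (auto simp: vimage_def)
    have one_le: "1 \<le> \<bar>real n - real m\<bar>" if "n \<noteq> m" for n m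
      using that by linarith
    fix x
    show "x \<in> (\<Union>n. A n) \<longleftrightarrow> (\<exists>\<alpha>. (x, \<alpha>) \<in> ?D)"
    proof
      assume "x \<in> (\<Union>n. A n)"
      then obtain n \<alpha> where "(x, \<alpha>) \<in> C n" using A by auto
      then have "(x, case_nat (real n) \<alpha>) \<in> ?D"
        using one_le by (auto simp del: One_nat_def) (metis)
      then show "\<exists>\<alpha>. (x, \<alpha>) \<in> ?D" by blast
    next
      assume "\<exists>\<alpha>. (x, \<alpha>) \<in> ?D"
      then obtain \<alpha> n where "\<alpha> 0 = real n" "(x, \<alpha>) \<in> ?D"
        by (auto elim: Nats_cases)
      then have "(x, \<lambda>k. \<alpha> (Suc k)) \<in> C n" by auto
      then show "x \<in> (\<Union>n. A n)" using A by blast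
    qed
  qed
qed

text \<open>Witnesses for all \<open>n\<close> are needed at once; \<open>prod_encode\<close> packs
  them into a single parameter.\<close>

lemma proj_closed_INT:
  fixes A :: "nat \<Rightarrow> 'a::topological_space set"
  assumes "\<And>n. proj_closed (A n)"
  shows "proj_closed (\<Inter>n. A n)"
proof -
  have "\<forall>n. \<exists>C. closed C \<and> (\<forall>x. x \<in> A n \<longleftrightarrow> (\<exists>\<alpha> :: nat \<Rightarrow> real. (x, \<alpha>) \<in> C))"
    using assms by (metis proj_closedE)
  then obtain C where C: "\<And>n. closed (C n)"
    and A: "\<And>n x. x \<in> A n \<longleftrightarrow> (\<exists>\<alpha> :: nat \<Rightarrow> real. (x, \<alpha>) \<in> C n)"
    by metis
  let ?D = "{p :: 'a \<times> (nat \<Rightarrow> real). \<forall>n. (fst p, \<lambda>k. snd p (prod_encode (n, k))) \<in> C n}"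
  show ?thesis
  proof (rule proj_closedI)
    show "closed ?D"
      using closed_vimage[OF C continuous_on_reindex[where 'a='a]]
      by (intro closed_Collect_all) (auto simp: vimage_def)
    fix x
    show "x \<in> (\<Inter>n. A n) \<longleftrightarrow> (\<exists>\<alpha>. (x, \<alpha>) \<in> ?D)"
    proof
      assume "x \<in> (\<Inter>n. A n)"
      then obtain \<alpha> where "\<And>n. (x, \<alpha> n) \<in> C n" using A by simp metis
      then have "(x, \<lambda>m. case_prod \<alpha> (prod_decode m)) \<in> ?D" by simp
      then show "\<exists>\<alpha>. (x, \<alpha>) \<in> ?D" by blast
    qed (use A in auto)
  qed
qed

text \<open>The complement is carried through the induction, since analytic sets are not closed
  under complements in general.\<close>

lemma borel_imp_proj_closed:
  assumes "B \<in> sets (borel :: 'a::metric_space measure)"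
  shows "proj_closed B"
proof -
  have "B \<in> sigma_sets UNIV {S :: 'a set. open S}"
    using assms by (simp add: borel_def)
  then have "proj_closed B \<and> proj_closed (- B)"
  proof induction
    case (Basic a) then show ?case by (simp add: proj_closed_open proj_closed_closed closed_Compl)
  next
    case Empty then show ?case by (simp add: proj_closed_closed)
  next
    case (Compl a) then show ?case by (metis Compl_eq_Diff_UNIV double_complement)
  next
    case (Union a)
    have "- (\<Union>n. a n) = (\<Inter>n. - a n)" by auto
    then show ?case using Union.IH proj_closed_UN[of a] proj_closed_INT[of "\<lambda>n. - a n"] by metis
  qed
  then show ?thesis ..
qed

section \<open>Separation of disjoint analytic sets by Borel sets\<close>

definition borel_sep :: "'a::topological_space set \<Rightarrow> 'a set \<Rightarrow> bool" where
  "borel_sep A B \<longleftrightarrow> (\<exists>S \<in> sets borel. A \<subseteq> S \<and> B \<inter> S = {})"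

text \<open>Intersecting over \<open>j\<close> separates one \<open>A i\<close> from every
  \<open>B j\<close>, and the union over \<open>i\<close> finishes. Read contrapositively,
  inseparability of two unions passes to some pair of pieces.\<close>

lemma borel_sep_UN:
  fixes A B :: "nat \<Rightarrow> 'a::topological_space set"
  assumes "\<And>i j. borel_sep (A i) (B j)"
  shows "borel_sep (\<Union>i. A i) (\<Union>j. B j)"
proof -
  obtain S where S: "\<And>i j. S i j \<in> sets borel" "\<And>i j. A i \<subseteq> S i j" "\<And>i j. B j \<inter> S i j = {}"
    using assms unfolding borel_sep_def by metis
  show ?thesis unfolding borel_sep_def
  proof (intro bexI conjI)
    show "(\<Union>i. \<Inter>j. S i j) \<in> sets borel" using S(1) by (intro sets.countable_UN sets.countable_INT) auto
    show "(\<Union>i. A i) \<subseteq> (\<Union>i. \<Inter>j. S i j)" using S(2) by fastforce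
    show "(\<Union>j. B j) \<inter> (\<Union>i. \<Inter>j. S i j) = {}" using S(3) by fastforce
  qed
qed

text \<open>If no separation exists, one can shrink both sets to pieces of diameter tending to zero that are
  still inseparable; the limit points then have the same image.\<close>

lemma lusin_separation:
  fixes p :: "'w::{complete_space, second_countable_topology} \<Rightarrow> 'a::t2_space"
  assumes p: "continuous_on UNIV p" and cl: "closed C" "closed D" and disj: "p ` C \<inter> p ` D = {}"
  shows "borel_sep (p ` C) (p ` D)"
proof (rule ccontr)
  assume insep: "\<not> borel_sep (p ` C) (p ` D)"
  obtain Q :: "'w set" where Q: "countable Q" and Qd: "\<And>X. open X \<Longrightarrow> X \<noteq> {} \<Longrightarrow> \<exists>d\<in>Q. d \<in> X"
    using countable_dense_setE by metis
  have "Q \<noteq> {}" using Qd[of UNIV] by auto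
  define q where "q = from_nat_into Q"
  have cov: "\<exists>i. x \<in> cball (q i) e" if e: "e > 0" for x e
  proof -
    obtain d where d: "d \<in> Q" "d \<in> ball x e" using Qd[of "ball x e"] e by auto
    then obtain i where "q i = d" unfolding q_def
      using from_nat_into_surj[OF Q] by auto
    then show ?thesis using d by (intro exI[of _ i]) (auto simp: dist_commute)
  qed
  define inseparable where "inseparable s \<longleftrightarrow> fst s \<subseteq> C \<and> snd s \<subseteq> D \<and> closed (fst s) \<and> closed (snd s) \<and>
    \<not> borel_sep (p ` fst s) (p ` snd s)" for s
  define small where "small Z n \<longleftrightarrow> (\<exists>c. Z \<subseteq> cball c ((1/2) ^ n))" for Z :: "'w set" and n :: nat
  define shrinks where "shrinks n s t \<longleftrightarrow> fst t \<subseteq> fst s \<and> snd t \<subseteq> snd s \<and> small (fst t) n \<and> small (snd t) n"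
    for n and s t :: "'w set \<times> 'w set"
  have "\<exists>f. \<forall>n. inseparable (f n) \<and> shrinks n (f n) (f (Suc n))"
  proof (rule dependent_nat_choice)
    show "\<exists>s. inseparable s" using cl insep by (intro exI[of _ "(C, D)"]) (auto simp: inseparable_def)
    fix s n
    assume s: "inseparable s"
    let ?A = "\<lambda>Z i. Z \<inter> cball (q i) ((1/2) ^ n)"
    have "Z = (\<Union>i. ?A Z i)" for Z using cov[of "(1/2) ^ n"] by fastforce
    then have im: "p ` Z = (\<Union>i. p ` ?A Z i)" for Z by blast
    have "\<exists>i j. \<not> borel_sep (p ` ?A (fst s) i) (p ` ?A (snd s) j)"
      using borel_sep_UN[of "\<lambda>i. p ` ?A (fst s) i" "\<lambda>i. p ` ?A (snd s) i"] s im
      unfolding inseparable_def by metis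
    then obtain i j where ij: "\<not> borel_sep (p ` ?A (fst s) i) (p ` ?A (snd s) j)" by blast
    show "\<exists>t. inseparable t \<and> shrinks n s t"
      using ij s by (intro exI[of _ "(?A (fst s) i, ?A (snd s) j)"])
        (auto simp: inseparable_def shrinks_def small_def)
  qed
  then obtain f where f: "\<And>n. inseparable (f n)" "\<And>n. shrinks n (f n) (f (Suc n))" by metis
  define X Y where "X n = fst (f n)" and "Y n = snd (f n)" for n
  have XY: "closed (X n)" "closed (Y n)" "\<not> borel_sep (p ` X n) (p ` Y n)"
    "X (Suc n) \<subseteq> X n" "Y (Suc n) \<subseteq> Y n" "small (X (Suc n)) n" "small (Y (Suc n)) n" for n
    using f[of n] unfolding X_def Y_def inseparable_def shrinks_def by auto
  \<comment> \<open>The empty set is separated from every set, so inseparable pieces are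
    nonempty.\<close>
  have ne: "X n \<noteq> {}" "Y n \<noteq> {}" for n
    using XY(3)[of n] unfolding borel_sep_def by auto
  \<comment> \<open>By completeness, nested nonempty closed sets of vanishing diameter shrink to one
    point; late members lie in any given neighbourhood of it.\<close>
  have nest: "\<exists>a. \<Inter> (range Z) = {a}" and shrink: "\<And>U a. open U \<Longrightarrow> a \<in> \<Inter> (range Z) \<Longrightarrow> a \<in> U \<Longrightarrow> \<exists>n. \<forall>m\<ge>n. Z m \<subseteq> U"
    if Z: "\<And>n. closed (Z n)" "\<And>n. Z n \<noteq> {}" "\<And>n. Z (Suc n) \<subseteq> Z n" "\<And>n. small (Z (Suc n)) n" for Z :: "nat \<Rightarrow> 'w set"
  proof -
    have mono: "Z n \<subseteq> Z m" if "m \<le> n" for m n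
      using lift_Suc_antimono_le[of Z m n] Z(3) that by auto
    have diam: "\<exists>n. \<forall>x\<in>Z n. \<forall>y\<in>Z n. dist x y < e" if e: "e > 0" for e
    proof -
      obtain n where n: "(1/2::real) ^ n < e / 2"
        using real_arch_pow_inv[of "e/2" "1/2"] e by auto
      obtain c where c: "Z (Suc n) \<subseteq> cball c ((1/2) ^ n)" using Z(4) unfolding small_def by blast
      have "dist x y < e" if "x \<in> Z (Suc n)" "y \<in> Z (Suc n)" for x y
      proof -
        have "dist c x \<le> (1/2) ^ n" "dist c y \<le> (1/2) ^ n" using c that by auto
        then show ?thesis using n dist_triangle3[of x y c] by linarith
      qed
      then show ?thesis by blast
    qed
    show "\<exists>a. \<Inter> (range Z) = {a}"
      by (rule decreasing_closed_nest_sing) (use Z mono diam in auto)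
    fix U a
    assume "open U" and a: "a \<in> \<Inter> (range Z)" and "a \<in> U"
    then obtain e where e: "e > 0" "ball a e \<subseteq> U" using openE by blast
    obtain n where n: "\<forall>x\<in>Z n. \<forall>y\<in>Z n. dist x y < e" using diam[OF e(1)] by blast
    have "Z m \<subseteq> U" if "m \<ge> n" for m
      using mono[OF that] n e(2) a by (auto simp: subset_iff)
    then show "\<exists>n. \<forall>m\<ge>n. Z m \<subseteq> U" by blast
  qed
  obtain a where a: "a \<in> \<Inter> (range X)"
    using nest[of X] XY ne by (metis insertI1)
  obtain b where b: "b \<in> \<Inter> (range Y)"
    using nest[of Y] XY ne by (metis insertI1)
  have "a \<in> C" "b \<in> D" using a b f(1)[of 0] unfolding X_def Y_def inseparable_def by auto
  then have "p a \<noteq> p b" using disj by blast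
  \<comment> \<open>Disjoint neighbourhoods of the two image points pull back to open sets
    containing late pieces, so \<open>U\<close> separates the images of these pieces.\<close>
  then obtain U V where UV: "open U" "open V" "p a \<in> U" "p b \<in> V" "U \<inter> V = {}"
    using hausdorff[of "p a" "p b"] by metis
  have "open (p -` U)" "open (p -` V)" using p UV by (auto intro: open_vimage)
  then obtain m n where "\<forall>k\<ge>m. X k \<subseteq> p -` U" "\<forall>k\<ge>n. Y k \<subseteq> p -` V"
    using shrink[of X "p -` U" a] shrink[of Y "p -` V" b] XY ne a b UV by auto
  then have "X (max m n) \<subseteq> p -` U" "Y (max m n) \<subseteq> p -` V" by auto
  then have "borel_sep (p ` X (max m n)) (p ` Y (max m n))"
    unfolding borel_sep_def using UV by (intro bexI[of _ U]) (auto simp: borel_open)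
  then show False using XY(3) by blast
qed

section \<open>Borel sets with finite sections\<close>

text \<open>Base 3 with digits 0 and 1 avoids the ambiguity of binary expansions: at the first
  different digit the sums differ by \<open>(1/3) ^ n\<close>, while all later digits contribute at
  most half of that.\<close>

lemma ternary_code_neq:
  fixes u v :: "nat \<Rightarrow> bool"
  assumes "u \<noteq> v"
  shows "(\<Sum>n. (1/3) ^ n * of_bool (u n)) \<noteq> (\<Sum>n. (1/3::real) ^ n * of_bool (v n))"
proof -
  define n where "n = (LEAST n. u n \<noteq> v n)"
  have "\<exists>n. u n \<noteq> v n" using assms by auto
  then have n: "u n \<noteq> v n" unfolding n_def by (rule LeastI_ex)
  have below: "u k = v k" if "k < n" for k using not_less_Least that unfolding n_def by blast
  have geo: "summable (\<lambda>k. (1/3::real) ^ k)" by (simp add: summable_geometric)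
  have sm: "summable (\<lambda>k. (1/3::real) ^ k * of_bool (w k))" for w
    by (rule summable_comparison_test'[OF geo]) auto
  define d where "d k = (1/3::real) ^ k * of_bool (u k) - (1/3) ^ k * of_bool (v k)" for k
  have d: "summable d" unfolding d_def by (intro summable_diff sm)
  have "(\<Sum>k. (1/3) ^ k * of_bool (u k)) - (\<Sum>k. (1/3::real) ^ k * of_bool (v k)) = suminf d"
    unfolding d_def by (intro suminf_diff sm)
  also have "\<dots> = (\<Sum>k. d (k + Suc n)) + sum d {..<Suc n}"
    by (rule suminf_split_initial_segment[OF d])
  also have "sum d {..<Suc n} = d n"
    using below by (simp add: d_def)
  finally have eq: "(\<Sum>k. (1/3) ^ k * of_bool (u k)) - (\<Sum>k. (1/3::real) ^ k * of_bool (v k)) =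
      (\<Sum>k. d (k + Suc n)) + d n" .
  have bound: "\<bar>d k\<bar> \<le> (1/3) ^ k" for k unfolding d_def by (auto simp: of_bool_def)
  have geo': "(\<lambda>k. (1/3::real) ^ (k + Suc n)) sums ((1/3) ^ Suc n * (3/2))"
    using sums_mult[OF geometric_sums[of "1/3::real"], of "(1/3) ^ Suc n"]
    by (simp add: power_add mult.commute)
  have "\<bar>\<Sum>k. d (k + Suc n)\<bar> \<le> (\<Sum>k. (1/3) ^ (k + Suc n))"
    using suminf_le[of "\<lambda>k. \<bar>d (k + Suc n)\<bar>"] bound geo'
    by (metis (no_types, lifting) norm_suminf_le real_norm_def sums_summable)
  also have "\<dots> = (1/3) ^ Suc n * (3/2)" using geo' by (rule sums_unique[symmetric])
  finally have "\<bar>\<Sum>k. d (k + Suc n)\<bar> \<le> (1/3) ^ n / 2" by simp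
  moreover have "\<bar>d n\<bar> = (1/3) ^ n" using n unfolding d_def by (auto simp: of_bool_def)
  moreover have "(0::real) < (1/3) ^ n" by simp
  ultimately show ?thesis using eq by linarith
qed

lemma ternary_code_range:
  "0 \<le> (\<Sum>n. (1/3::real) ^ n * of_bool (u n))" "(\<Sum>n. (1/3::real) ^ n * of_bool (u n)) < 2"
proof -
  have geo: "summable (\<lambda>k. (1/3::real) ^ k)" by (simp add: summable_geometric)
  have sm: "summable (\<lambda>k. (1/3::real) ^ k * of_bool (u k))"
    by (rule summable_comparison_test'[OF geo]) auto
  show "0 \<le> (\<Sum>n. (1/3::real) ^ n * of_bool (u n))" by (intro suminf_nonneg sm) auto
  have "(\<Sum>n. (1/3::real) ^ n * of_bool (u n)) \<le> (\<Sum>n. (1/3::real) ^ n)"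
    by (intro suminf_le sm geo) auto
  also have "\<dots> = 3/2" using geometric_sums[of "1/3::real"] by (simp add: sums_iff)
  finally show "(\<Sum>n. (1/3::real) ^ n * of_bool (u n)) < 2" by simp
qed

text \<open>The ternary digits of \<open>j x\<close> record which sets of a countable base contain
  \<open>x\<close>; a base of a Hausdorff space separates points. The strict bound leaves 2 free as
  a default value above all keys.\<close>

lemma borel_injection_real:
  obtains j :: "'a::{second_countable_topology, t2_space} \<Rightarrow> real"
  where "j \<in> borel_measurable borel" "inj j" "\<And>x. 0 \<le> j x" "\<And>x. j x < 2"
proof -
  obtain B :: "'a set set" where B: "countable B" "topological_basis B"
    using ex_countable_basis by blast
  have "B \<noteq> {}" using B(2) topological_basisE[OF B(2) open_UNIV UNIV_I] by auto
  define U where "U = from_nat_into B"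
  have U: "open (U n)" for n
    unfolding U_def using topological_basis_open[OF B(2) from_nat_into[OF \<open>B \<noteq> {}\<close>]] .
  have sep: "(\<lambda>n. x \<in> U n) \<noteq> (\<lambda>n. y \<in> U n)" if xy: "x \<noteq> y" for x y
  proof -
    obtain V where "open V" "x \<in> V" "y \<notin> V" using hausdorff[OF xy] by blast
    then obtain W where "W \<in> B" "x \<in> W" "W \<subseteq> V" using topological_basisE[OF B(2)] by metis
    moreover obtain n where "U n = W"
      using from_nat_into_surj[OF B(1) \<open>W \<in> B\<close>] unfolding U_def by auto
    ultimately show ?thesis using \<open>y \<notin> V\<close> by (metis subsetD)
  qed
  let ?j = "\<lambda>x. \<Sum>n. (1/3::real) ^ n * of_bool (x \<in> U n)"
  show ?thesis
  proof (rule that[of ?j])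
    have [measurable]: "U n \<in> sets borel" for n using U by simp
    show "?j \<in> borel_measurable borel" unfolding of_bool_def by measurable
    show "inj ?j" using sep ternary_code_neq by (intro injI) metis
  qed (rule ternary_code_range)+
qed

section \<open>Borel extension of partial functions with Borel graph\<close>

lemma separating_borel_set:
  fixes B :: "('a::{complete_space, second_countable_topology} \<times> 'b::{complete_space, second_countable_topology}) set"
  assumes [measurable]: "B \<in> sets borel" "U \<in> sets borel"
    and unique: "\<And>x y y'. (x, y) \<in> B \<Longrightarrow> (x, y') \<in> B \<Longrightarrow> y = y'"
  shows "\<exists>D \<in> sets borel. \<forall>(x, y) \<in> B. x \<in> D \<longleftrightarrow> y \<in> U"
proof -
  have "B \<inter> (UNIV \<times> V) \<in> sets borel" if "V \<in> sets borel" for V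
    using that assms(1) by (intro sets.Int) (auto simp: borel_prod[symmetric])
  then have "proj_closed (B \<inter> (UNIV \<times> U))" "proj_closed (B \<inter> (UNIV \<times> - U))"
    using assms(2) by (auto intro!: borel_imp_proj_closed)
  then obtain C D :: "(('a \<times> 'b) \<times> (nat \<Rightarrow> real)) set"
    where C: "closed C" "fst ` C = B \<inter> (UNIV \<times> U)" and D: "closed D" "fst ` D = B \<inter> (UNIV \<times> - U)"
    unfolding proj_closed_def by metis
  let ?p = "fst \<circ> fst :: ('a \<times> 'b) \<times> (nat \<Rightarrow> real) \<Rightarrow> 'a"
  \<comment> \<open>A section of \<open>B\<close> has at most one point, so no \<open>x\<close> lies
    both under the part of \<open>B\<close> over \<open>U\<close> and under the part over its
    complement.\<close>
  have "?p ` C \<inter> ?p ` D = {}"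
    unfolding image_comp[symmetric] C D using unique by force
  then have "borel_sep (?p ` C) (?p ` D)"
    by (intro lusin_separation C(1) D(1)) (auto intro!: continuous_intros simp: comp_def)
  then obtain S where S: "S \<in> sets borel" "?p ` C \<subseteq> S" "?p ` D \<inter> S = {}"
    unfolding borel_sep_def by blast
  then show ?thesis
    unfolding image_comp[symmetric] C D by (intro bexI[of _ S]) (auto simp: image_def, force+)
qed

text \<open>The number \<open>h y\<close> is recovered from \<open>x\<close> as the supremum of the
  rationals below it, since each condition \<open>q < h y\<close> is decided by a Borel set of
  points \<open>x\<close>.\<close>

lemma functional_borel_set_real:
  fixes B :: "('a::{complete_space, second_countable_topology} \<times> 'b::{complete_space, second_countable_topology}) set"
  assumes B: "B \<in> sets borel" and h: "h \<in> borel_measurable borel"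
    and unique: "\<And>x y y'. (x, y) \<in> B \<Longrightarrow> (x, y') \<in> B \<Longrightarrow> y = y'"
  shows "\<exists>f :: 'a \<Rightarrow> real. f \<in> borel_measurable borel \<and> (\<forall>(x, y) \<in> B. f x = h y)"
proof -
  have "\<exists>D \<in> sets borel. \<forall>(x, y) \<in> B. x \<in> D \<longleftrightarrow> y \<in> {y. real_of_rat q < h y}" for q
    using h by (intro separating_borel_set[OF B _ unique]) auto
  then have "\<forall>q. \<exists>D. D \<in> sets borel \<and> (\<forall>x y. (x, y) \<in> B \<longrightarrow> (x \<in> D \<longleftrightarrow> real_of_rat q < h y))"
    by fastforce
  from choice[OF this] obtain D where D: "\<And>q. D q \<in> sets borel"
    "\<And>q x y. (x, y) \<in> B \<Longrightarrow> x \<in> D q \<longleftrightarrow> real_of_rat q < h y" by blast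
  \<comment> \<open>Outside the projection of \<open>B\<close> the sets \<open>D q\<close> are
    uncontrolled and the supremum may be infinite, hence \<open>ereal\<close> here and
    \<open>real_of_ereal\<close> at the end.\<close>
  let ?f = "\<lambda>x. SUP q. if x \<in> D q then ereal (real_of_rat q) else - \<infinity>"
  have "?f x = ereal (h y)" if xy: "(x, y) \<in> B" for x y
  proof (rule antisym)
    show "?f x \<le> ereal (h y)" using D(2)[OF xy] by (intro SUP_least) (auto intro: less_imp_le)
    show "ereal (h y) \<le> ?f x"
    proof (rule dense_le)
      fix z assume z: "z < ereal (h y)"
      show "z \<le> ?f x"
      proof (cases "z = - \<infinity>")
        case False
        then obtain r where r: "z = ereal r" using z by (cases z) auto
        then obtain q where "r < real_of_rat q" "real_of_rat q < h y" using z of_rat_dense by auto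
        then show ?thesis using D(2)[OF xy] r by (intro SUP_upper2[of q]) auto
      qed simp
    qed
  qed
  moreover have "?f \<in> borel_measurable borel"
    using D(1) by (intro borel_measurable_SUP measurable_If) auto
  ultimately show ?thesis
    by (intro exI[of _ "\<lambda>x. real_of_ereal (?f x)"]) auto
qed

lemma functional_borel_set:
  fixes B :: "('a::{complete_space, second_countable_topology} \<times> (nat \<Rightarrow> real)) set"
  assumes B: "B \<in> sets borel" and unique: "\<And>x y y'. (x, y) \<in> B \<Longrightarrow> (x, y') \<in> B \<Longrightarrow> y = y'"
  obtains f where "f \<in> borel_measurable borel" "\<And>x y. (x, y) \<in> B \<Longrightarrow> f x = y"
proof -
  have "\<exists>f. f \<in> borel_measurable borel \<and> (\<forall>(x, y) \<in> B. f x = y k)" for k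
    by (rule functional_borel_set_real[OF B _ unique]) auto
  then have "\<forall>k. \<exists>f. f \<in> borel_measurable borel \<and> (\<forall>x y. (x, y) \<in> B \<longrightarrow> f x = y k)" by fastforce
  from choice[OF this] obtain f where f: "\<And>k. f k \<in> borel_measurable borel" "\<And>k x y. (x, y) \<in> B \<Longrightarrow> f k x = y k"
    by blast
  show ?thesis
    by (rule that[of "\<lambda>x k. f k x"]) (use f in \<open>auto intro!: measurable_coordinatewise_then_product\<close>)
qed

section \<open>Borel enumeration of finite sections, a bounded case of the Lusin-Novikov
  theorem\<close>

definition measurable_enumeration :: "'a measure \<Rightarrow> ('a \<times> 'a) set \<Rightarrow> (nat \<Rightarrow> 'a \<Rightarrow> 'a) \<Rightarrow> bool" where
  "measurable_enumeration M E f \<longleftrightarrow> (\<forall>i. f i \<in> measurable M M) \<and>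
     (\<lambda>v. card (nbhd E v)) \<in> measurable M (count_space UNIV) \<and>
     (\<forall>v\<in>space M. bij_betw (\<lambda>i. f i v) {..<card (nbhd E v)} (nbhd E v))"

lemma bij_betw_case_nat:
  assumes "bij_betw h {..<n} (A - {a})" and "a \<in> A"
  shows "bij_betw (case_nat a h) {..<Suc n} A"
proof -
  have h: "inj_on h {..<n}" "h ` {..<n} = A - {a}" using assms(1) by (auto simp: bij_betw_def)
  have "inj_on (case_nat a h) {..<Suc n}"
    using h by (auto simp: inj_on_def image_def split: nat.splits)
  moreover have "case_nat a h ` {..<Suc n} = A"
    using h(2) assms(2) by (auto simp: lessThan_Suc_eq_insert_0 image_image)
  ultimately show ?thesis unfolding bij_betw_def by blast
qed

text \<open>A pair of sequences is coded as one sequence, so that the induction below can apply its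
  hypothesis to a relation over pairs without changing the type.\<close>

definition evens :: "(nat \<Rightarrow> 'b) \<Rightarrow> nat \<Rightarrow> 'b" where "evens w n = w (2 * n)"
definition odds :: "(nat \<Rightarrow> 'b) \<Rightarrow> nat \<Rightarrow> 'b" where "odds w n = w (2 * n + 1)"
definition interleave :: "(nat \<Rightarrow> 'b) \<Rightarrow> (nat \<Rightarrow> 'b) \<Rightarrow> nat \<Rightarrow> 'b" where
  "interleave x y n = (if even n then x (n div 2) else y (n div 2))"

lemma evens_interleave [simp]: "evens (interleave x y) = x"
  and odds_interleave [simp]: "odds (interleave x y) = y"
  by (auto simp: evens_def odds_def interleave_def)

lemma measurable_evens [measurable]: "evens \<in> borel_measurable (borel :: (nat \<Rightarrow> real) measure)"
  by (rule measurable_coordinatewise_then_product)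
    (simp add: evens_def borel_measurable_continuous_onI)

lemma measurable_odds [measurable]: "odds \<in> borel_measurable (borel :: (nat \<Rightarrow> real) measure)"
  by (rule measurable_coordinatewise_then_product)
    (simp add: odds_def borel_measurable_continuous_onI)

lemma measurable_interleave [measurable]:
  fixes f g :: "'a \<Rightarrow> nat \<Rightarrow> real"
  assumes [measurable]: "f \<in> borel_measurable M" "g \<in> borel_measurable M"
  shows "(\<lambda>x. interleave (f x) (g x)) \<in> borel_measurable M"
proof (rule measurable_coordinatewise_then_product)
  fix i
  show "(\<lambda>x. interleave (f x) (g x) i) \<in> borel_measurable M"
    using measurable_product_then_coordinatewise[OF assms(1)] measurable_product_then_coordinatewise[OF assms(2)]
    by (cases "even i") (auto simp: interleave_def)
qed

lemma finite_has_min_key: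
  fixes j :: "'a \<Rightarrow> real"
  assumes "finite A" "A \<noteq> {}"
  shows "\<exists>y\<in>A. \<forall>y'\<in>A. j y \<le> j y'"
  using ex_min_if_finite[of "j ` A"] assms by (metis (no_types, lifting) arg_min_least arg_min_if_finite(1))

lemma nbhd_iff [simp]: "u \<in> nbhd E v \<longleftrightarrow> (v, u) \<in> E"
  by (simp add: nbhd_def)

text \<open>One enumerates the points of a section in increasing order of an injective Borel key. Whether a point of
  the section over \<open>x\<close> has minimal key is Borel, since the other points of the section form a section of a
  Borel set with smaller sections, this time over pairs coded by interleaving.\<close>

lemma measurable_enumeration_borel:
  fixes B :: "((nat \<Rightarrow> real) \<times> (nat \<Rightarrow> real)) set"
  assumes "B \<in> sets borel" and "\<And>x. finite (nbhd B x)" and "\<And>x. card (nbhd B x) \<le> d"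
  shows "\<exists>f. measurable_enumeration borel B f"
  using assms
proof (induction d arbitrary: B)
  case 0
  then have "nbhd B x = {}" for x by (metis card_0_eq le_zero_eq)
  then show ?case
    by (intro exI[of _ "\<lambda>_ x. x"]) (simp add: measurable_enumeration_def bij_betw_def)
next
  case (Suc d B)
  note B[measurable] = Suc.prems(1)
  have pairI: "{p. P p} \<in> sets borel"
    if "Measurable.pred (borel \<Otimes>\<^sub>M borel) P" for P :: "(nat \<Rightarrow> real) \<times> (nat \<Rightarrow> real) \<Rightarrow> bool"
    using that by (simp add: borel_prod pred_def)
  have B'[measurable]: "B \<in> sets (borel \<Otimes>\<^sub>M borel)" unfolding borel_prod by (rule B)
  obtain j :: "(nat \<Rightarrow> real) \<Rightarrow> real" where j[measurable]: "j \<in> borel_measurable borel" and "inj j"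
    using borel_injection_real by metis
  then have j_eq: "j x = j y \<longleftrightarrow> x = y" for x y by (auto dest: injD)
  \<comment> \<open>If \<open>w\<close> codes a pair \<open>(x, y)\<close> of \<open>B\<close>, its
    section in \<open>C\<close> consists of the other points over \<open>x\<close>; this lowers the
    section bound from \<open>Suc d\<close> to \<open>d\<close>.\<close>
  define C where "C = {p. (evens (fst p), odds (fst p)) \<in> B \<and> (evens (fst p), snd p) \<in> B \<and> j (snd p) \<noteq> j (odds (fst p))}"
  have C: "C \<in> sets borel" unfolding C_def by (rule pairI) measurable
  have nbhd_C: "nbhd C w = (if (evens w, odds w) \<in> B then nbhd B (evens w) - {odds w} else {})" for w
    by (auto simp: C_def j_eq)
  have "\<exists>g. measurable_enumeration borel C g"
  proof (rule Suc.IH[OF C])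
    show "finite (nbhd C w)" for w using Suc.prems(2) by (simp add: nbhd_C)
    show "card (nbhd C w) \<le> d" for w
    proof (cases "(evens w, odds w) \<in> B")
      case True
      then have "card (nbhd C w) = card (nbhd B (evens w)) - 1" by (simp add: nbhd_C)
      then show ?thesis using Suc.prems(3)[of "evens w"] by linarith
    qed (simp add: nbhd_C)
  qed
  then obtain g where "measurable_enumeration borel C g" ..
  then have g[measurable]: "g i \<in> borel_measurable borel"
    and g_bij: "bij_betw (\<lambda>i. g i w) {..<card (nbhd C w)} (nbhd C w)" for i w
    by (simp_all add: measurable_enumeration_def)
  \<comment> \<open>The values \<open>g i\<close> beyond the section size are arbitrary, so
    membership in \<open>B\<close> is tested first; an arbitrary value passing the test is a point
    of the section and does no harm.\<close>
  define D where "D = {p. p \<in> B \<and> (\<forall>i. (fst p, g i (interleave (fst p) (snd p))) \<in> B \<longrightarrow>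
      j (snd p) \<le> j (g i (interleave (fst p) (snd p))))}"
  have D[measurable]: "D \<in> sets borel" unfolding D_def by (rule pairI) measurable
  have D_iff: "(x, y) \<in> D \<longleftrightarrow> (x, y) \<in> B \<and> (\<forall>y'. (x, y') \<in> B \<longrightarrow> j y \<le> j y')" for x y
  proof (intro iffI conjI allI impI)
    fix y' assume xy: "(x, y) \<in> D" and y': "(x, y') \<in> B"
    show "j y \<le> j y'"
    proof (cases "y' = y")
      case False
      then have "y' \<in> nbhd C (interleave x y)" using xy y' by (auto simp: C_def D_def j_eq)
      then obtain i where "y' = g i (interleave x y)"
        using bij_betw_imp_surj_on[OF g_bij[of "interleave x y"]] by blast
      then show ?thesis using xy y' by (auto simp: D_def)
    qed simp
  qed (auto simp: D_def)
  have D_unique: "y = y'" if "(x, y) \<in> D" "(x, y') \<in> D" for x y y'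
    using that j_eq by (metis D_iff order_antisym)
  \<comment> \<open>Points of minimal key are unique because \<open>j\<close> is injective, so
    \<open>D\<close> is the graph of a partial function, which extends to a total Borel one.\<close>
  obtain f0 where f0[measurable]: "f0 \<in> borel_measurable borel" and f0_eq: "\<And>x y. (x, y) \<in> D \<Longrightarrow> f0 x = y"
    using functional_borel_set[OF D] D_unique by metis
  have f0_D: "(x, f0 x) \<in> D" if ne: "nbhd B x \<noteq> {}" for x
  proof -
    obtain y where "y \<in> nbhd B x" "\<forall>y'\<in>nbhd B x. j y \<le> j y'"
      using finite_has_min_key[OF Suc.prems(2) ne, of j] by blast
    then have "(x, y) \<in> D" by (simp add: D_iff nbhd_def)
    then show ?thesis using f0_eq by simp
  qed
  have nbhd_BD: "nbhd (B - D) x = nbhd B x - {f0 x}" for x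
  proof (cases "nbhd B x = {}")
    case False
    then have "(x, u) \<in> D \<longleftrightarrow> u = f0 x" for u using f0_eq f0_D by blast
    then show ?thesis by (auto simp: nbhd_def)
  qed (auto simp: nbhd_def)
  \<comment> \<open>The Borel test \<open>(x, f0 x) \<in> D\<close> decides whether the section is
    nonempty, so the cardinality is measurable by recursion.\<close>
  have card_B: "card (nbhd B x) = (if (x, f0 x) \<in> D then Suc (card (nbhd (B - D) x)) else 0)" for x
  proof (cases "nbhd B x = {}")
    case False
    have "f0 x \<in> nbhd B x" using f0_D[OF False] by (simp add: D_iff)
    then show ?thesis using f0_D[OF False] card_Suc_Diff1[OF Suc.prems(2)] by (simp add: nbhd_BD)
  qed (auto simp: D_iff)
  have "\<exists>f. measurable_enumeration borel (B - D) f"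
  proof (rule Suc.IH)
    show "B - D \<in> sets borel" by measurable
    show "finite (nbhd (B - D) x)" for x using Suc.prems(2) by (simp add: nbhd_BD)
    show "card (nbhd (B - D) x) \<le> d" for x
    proof (cases "nbhd B x = {}")
      case False
      then show ?thesis using card_B[of x] Suc.prems(3)[of x] f0_D by simp
    qed (simp add: nbhd_BD)
  qed
  then obtain f where "measurable_enumeration borel (B - D) f" ..
  then have f[measurable]: "f i \<in> borel_measurable borel"
    and card_BD[measurable]: "(\<lambda>x. card (nbhd (B - D) x)) \<in> measurable borel (count_space UNIV)"
    and f_bij: "bij_betw (\<lambda>i. f i x) {..<card (nbhd (B - D) x)} (nbhd (B - D) x)" for i x
    by (simp_all add: measurable_enumeration_def)
  have "measurable_enumeration borel B (case_nat f0 f)"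
    unfolding measurable_enumeration_def
  proof (intro conjI allI ballI)
    show "case_nat f0 f i \<in> borel_measurable borel" for i by (cases i) auto
    show "(\<lambda>x. card (nbhd B x)) \<in> measurable borel (count_space UNIV)"
      unfolding card_B by measurable
    fix x
    show "bij_betw (\<lambda>i. case_nat f0 f i x) {..<card (nbhd B x)} (nbhd B x)"
    proof (cases "nbhd B x = {}")
      case False
      have "bij_betw (case_nat (f0 x) (\<lambda>i. f i x)) {..<Suc (card (nbhd (B - D) x))} (nbhd B x)"
        using f_bij[of x] f0_D[OF False] by (intro bij_betw_case_nat) (auto simp: nbhd_BD D_iff)
      moreover have "case_nat (f0 x) (\<lambda>i. f i x) = (\<lambda>i. case_nat f0 f i x)"
        by (auto split: nat.split)
      ultimately show ?thesis using f0_D[OF False] card_B[of x] by simp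
    qed (simp add: bij_betw_def)
  qed
  then show ?case by blast
qed

section \<open>Embedding a standard Borel space into the real sequences\<close>

lemma standard_borel_embedding:
  assumes "standard_borel M"
  obtains \<psi> :: "'a \<Rightarrow> nat \<Rightarrow> real"
  where "\<psi> \<in> borel_measurable M" "inj_on \<psi> (space M)" "\<And>A. A \<in> sets M \<Longrightarrow> \<psi> ` A \<in> sets borel"
proof -
  obtain X where X: "topspace X = space M" "completely_metrizable_space X" "separable_space X"
    "sets M = sigma_sets (space M) {U. openin X U}"
    using assms unfolding standard_borel_def by blast
  then obtain V d where "Metric_space V d" and compl: "Metric_space.mcomplete V d"
    and Xd: "X = Metric_space.mtopology V d" unfolding completely_metrizable_space_def by blast
  interpret Metric_space V d by fact
  have V: "V = space M" using X(1) Xd by simp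
  have open_sets: "U \<in> sets M" if "openin X U" for U using that X(4) by auto
  show ?thesis
  proof (cases "V = {}")
    case True
    then have "space M = {}" "sets M = {{}}" using V sets.sets_into_space[of _ M] by (auto simp: subset_iff)
    then show ?thesis by (intro that[of undefined]) (auto simp: measurable_def)
  next
    case False
    obtain Q where Q: "countable Q" "Q \<subseteq> V" "X closure_of Q = V"
      using X(3) Xd unfolding separable_space_def by auto
    then have "Q \<noteq> {}" using False by auto
    define q where "q = from_nat_into Q"
    have q: "q n \<in> V" for n unfolding q_def using from_nat_into[OF \<open>Q \<noteq> {}\<close>] Q(2) by blast
    have dense: "\<exists>n. d x (q n) < e" if x: "x \<in> V" and e: "e > 0" for x e
    proof -
      have "x \<in> mtopology closure_of Q" using Q(3) x Xd by simp
      then obtain y where "y \<in> Q" "y \<in> mball x e"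
        using e unfolding metric_closure_of by blast
      moreover obtain n where "q n = y"
        using from_nat_into_surj[OF Q(1) \<open>y \<in> Q\<close>] unfolding q_def by auto
      ultimately show ?thesis by (auto simp: in_mball)
    qed
    \<comment> \<open>A point is coded by its distances to a dense sequence.\<close>
    define \<psi> where "\<psi> x n = d x (q n)" for x n
    have meas: "\<psi> \<in> borel_measurable M"
    proof (rule measurable_coordinatewise_then_product)
      fix n
      have "{x \<in> space M. \<psi> x n < a} = mball (q n) a" for a
        using q[of n] unfolding V[symmetric] by (auto simp: \<psi>_def commute)
      then show "(\<lambda>x. \<psi> x n) \<in> borel_measurable M"
        using open_sets Xd by (simp add: borel_measurable_iff_less)
    qed
    have inj: "inj_on \<psi> (space M)"
    proof (rule inj_onI, rule ccontr)
      fix x y assume xy: "x \<in> space M" "y \<in> space M" "\<psi> x = \<psi> y" "x \<noteq> y"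
      then have "d x y > 0" using V by (simp add: mdist_pos_less)
      then obtain n where n: "d x (q n) < d x y / 2" using dense[of x "d x y / 2"] xy V by auto
      have "d y (q n) = d x (q n)" using fun_cong[OF xy(3), of n] by (simp add: \<psi>_def)
      then show False using n triangle[of x "q n" y] xy V q commute[of y "q n"] by simp
    qed
    \<comment> \<open>A limit of codes need not be the code of a point. If it has arbitrarily small
      coordinates, the preimages come close to some \<open>q n\<close> and are Cauchy; completeness
      then gives a preimage of the limit.\<close>
    have range: "\<psi> ` V = closure (\<psi> ` V) \<inter> {y. \<forall>k. \<exists>n. y n < inverse (real (Suc k))}"
    proof (intro equalityI subsetI IntI)
      fix y assume "y \<in> \<psi> ` V"
      then show "y \<in> closure (\<psi> ` V)" by (rule subsetD[OF closure_subset])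
      show "y \<in> {y. \<forall>k. \<exists>n. y n < inverse (real (Suc k))}" using dense \<open>y \<in> \<psi> ` V\<close> by (auto simp: \<psi>_def)
    next
      fix y assume "y \<in> closure (\<psi> ` V) \<inter> {y. \<forall>k. \<exists>n. y n < inverse (real (Suc k))}"
      then have cl: "y \<in> closure (\<psi> ` V)" and small: "\<And>k. \<exists>n. y n < inverse (real (Suc k))" by auto
      obtain z where z: "\<And>k. z k \<in> \<psi> ` V" "z \<longlonglongrightarrow> y" using cl unfolding closure_sequential by auto
      define x where "x k = (SOME x. x \<in> V \<and> z k = \<psi> x)" for k
      have x: "x k \<in> V \<and> z k = \<psi> (x k)" for k
        unfolding x_def by (rule someI_ex) (use z(1) in blast)
      have lim: "(\<lambda>k. d (x k) (q n)) \<longlonglongrightarrow> y n" for n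
        using continuous_on_tendsto_compose[OF continuous_on_product_coordinates[of n] z(2)] x
        by (simp add: \<psi>_def)
      have "MCauchy x" unfolding MCauchy_def
      proof (intro conjI allI impI)
        show "range x \<subseteq> V" using x by auto
        fix e :: real assume "e > 0"
        then obtain k where k: "inverse (real (Suc k)) < e / 2" using reals_Archimedean[of "e/2"] by auto
        obtain n where "y n < e / 2" using small[of k] k less_trans by blast
        then obtain N where N: "\<And>i. i \<ge> N \<Longrightarrow> d (x i) (q n) < e / 2"
          using order_tendstoD(2)[OF lim] unfolding eventually_sequentially by meson
        have "d (x i) (x i') < e" if "N \<le> i" "N \<le> i'" for i i'
          using N[OF that(1)] N[OF that(2)] triangle[of "x i" "q n" "x i'"] x q commute[of "x i'" "q n"] by force
        then show "\<exists>N. \<forall>i i'. N \<le> i \<longrightarrow> N \<le> i' \<longrightarrow> d (x i) (x i') < e" by blast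
      qed
      then obtain l where "limitin mtopology x l sequentially" using compl unfolding mcomplete_def by blast
      then have l: "l \<in> V" "\<And>e. e > 0 \<Longrightarrow> \<exists>N. \<forall>n\<ge>N. x n \<in> V \<and> d (x n) l < e"
        unfolding limit_metric_sequentially by auto
      have "(\<lambda>k. d (x k) (q n)) \<longlonglongrightarrow> d l (q n)" for n
      proof (rule LIMSEQ_I)
        fix e :: real assume "e > 0"
        then obtain N where N: "\<And>k. k \<ge> N \<Longrightarrow> d (x k) l < e" using l(2) by blast
        have "norm (d (x k) (q n) - d l (q n)) < e" if "k \<ge> N" for k
          using N[OF that] triangle[of "x k" l "q n"] triangle[of l "x k" "q n"] x[of k] l(1) q[of n]
            commute[of "x k" l] by (auto simp: abs_less_iff)
        then show "\<exists>N. \<forall>k\<ge>N. norm (d (x k) (q n) - d l (q n)) < e" by blast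
      qed
      then have "y = \<psi> l" using LIMSEQ_unique[OF lim] by (auto simp: \<psi>_def)
      then show "y \<in> \<psi> ` V" using l(1) by blast
    qed
    have [measurable]: "(\<lambda>y. y n) \<in> borel_measurable (borel :: (nat \<Rightarrow> real) measure)" for n
      by (simp add: borel_measurable_continuous_onI)
    have [measurable]: "closure (\<psi> ` V) \<in> sets borel" by auto
    have range_sets: "\<psi> ` V \<in> sets borel"
    proof -
      have "{y \<in> space borel. \<forall>k. \<exists>n. y n < inverse (real (Suc k))} \<in> sets (borel :: (nat \<Rightarrow> real) measure)"
        by measurable
      then show ?thesis by (subst range) auto
    qed
    have "\<psi> ` A \<in> sets borel" if A: "A \<in> sets M" for A
      using A[unfolded X(4)]
    proof induction
      case (Basic U)
      then have U: "openin mtopology U" using Xd by simp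
      \<comment> \<open>A ball around \<open>q n\<close> is a bound on coordinate \<open>n\<close>
        of the code, so the countably many such balls inside \<open>U\<close> describe its image
        within the range.\<close>
      define I where "I = {(n, k). mball (q n) (inverse (real (Suc k))) \<subseteq> U}"
      have "\<psi> ` U = \<psi> ` V \<inter> (\<Union>(n, k)\<in>I. {y. y n < inverse (real (Suc k))})"
      proof (intro equalityI subsetI)
        fix y assume "y \<in> \<psi> ` U"
        then obtain x where x: "x \<in> U" "y = \<psi> x" by blast
        then obtain e where e: "e > 0" "mball x e \<subseteq> U" and xV: "x \<in> V" using U unfolding openin_mtopology by blast
        obtain k where k: "inverse (real (Suc k)) < e / 2" using reals_Archimedean[of "e/2"] e by auto
        obtain n where n: "d x (q n) < inverse (real (Suc k))" using dense[OF xV, of "inverse (real (Suc k))"] by auto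
        have "mball (q n) (inverse (real (Suc k))) \<subseteq> mball x e"
        proof
          fix u assume "u \<in> mball (q n) (inverse (real (Suc k)))"
          then show "u \<in> mball x e"
            using triangle[of x "q n" u] n k xV q[of n] by auto
        qed
        then have "(n, k) \<in> I" using e(2) by (auto simp: I_def)
        then show "y \<in> \<psi> ` V \<inter> (\<Union>(n, k)\<in>I. {y. y n < inverse (real (Suc k))})"
          using n x xV by (auto simp: \<psi>_def intro!: bexI[of _ "(n, k)"])
      next
        fix y assume "y \<in> \<psi> ` V \<inter> (\<Union>(n, k)\<in>I. {y. y n < inverse (real (Suc k))})"
        then obtain x n k where x: "x \<in> V" "y = \<psi> x" and nk: "(n, k) \<in> I" "y n < inverse (real (Suc k))" by auto
        then have "x \<in> mball (q n) (inverse (real (Suc k)))" using q[of n] by (simp add: \<psi>_def commute)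
        then show "y \<in> \<psi> ` U" using nk x unfolding I_def by blast
      qed
      moreover have "{y. y n < inverse (real (Suc k))} \<in> sets (borel :: (nat \<Rightarrow> real) measure)" for n k
        by simp
      ultimately show ?case using range_sets by (auto intro!: sets.Int sets.countable_UN')
    next
      case (Compl A)
      have "A \<subseteq> space M" using sets.sets_into_space[of A M] Compl.hyps X(4) by simp
      then have "\<psi> ` (space M - A) = \<psi> ` V - \<psi> ` A" using inj V by (simp add: inj_on_image_set_diff)
      then show ?case using Compl.IH range_sets by auto
    next
      case (Union A)
      then show ?case by (auto simp: image_UN)
    qed simp
    then show ?thesis using that[of \<psi>] meas inj by blast
  qed
qed

section \<open>Standard Borel graphs\<close>

text \<open>The graph is copied into the real sequences along \<open>\<psi>\<close>, enumerated
  there, and pulled back.\<close>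

lemma exists_measurable_enumeration:
  assumes "borel_graph M E" "bounded_degree M E"
  shows "\<exists>f. measurable_enumeration M E f"
proof (cases "space M = {}")
  case True
  then have "(\<lambda>v. card (nbhd E v)) \<in> measurable M (count_space UNIV)"
    by (auto simp: measurable_def)
  then show ?thesis
    using True by (intro exI[of _ "\<lambda>_ x. x"]) (auto simp: measurable_enumeration_def)
next
  case False
  then obtain v0 where v0: "v0 \<in> space M" by blast
  have E[measurable]: "E \<in> sets (M \<Otimes>\<^sub>M M)" and E_sub: "E \<subseteq> space M \<times> space M" and "standard_borel M"
    using assms(1) unfolding borel_graph_def by auto
  then obtain \<psi> :: "'a \<Rightarrow> nat \<Rightarrow> real" where \<psi>[measurable]: "\<psi> \<in> borel_measurable M"
    and inj: "inj_on \<psi> (space M)" and \<psi>_sets: "\<And>A. A \<in> sets M \<Longrightarrow> \<psi> ` A \<in> sets borel"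
    using standard_borel_embedding by blast
  obtain d where d: "\<And>v. v \<in> space M \<Longrightarrow> finite (nbhd E v)" "\<And>v. v \<in> space M \<Longrightarrow> card (nbhd E v) \<le> d"
    using assms(2) unfolding bounded_degree_def by blast
  \<comment> \<open>A Borel left inverse of \<open>\<psi>\<close>, with the default
    \<open>v0\<close> off the range.\<close>
  define g where "g y = (if y \<in> \<psi> ` space M then inv_into (space M) \<psi> y else v0)" for y
  have g_\<psi>[simp]: "g (\<psi> v) = v" if "v \<in> space M" for v using inj that by (simp add: g_def)
  have range[measurable]: "\<psi> ` space M \<in> sets borel" using \<psi>_sets by simp
  have g[measurable]: "g \<in> measurable borel M"
  proof (rule measurableI)
    show "g y \<in> space M" for y using v0 by (auto simp: g_def intro: inv_into_into)
    fix A assume A: "A \<in> sets M"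
    then have "g -` A \<inter> space borel = \<psi> ` A \<union> (if v0 \<in> A then - \<psi> ` space M else {})"
      using sets.sets_into_space[OF A] by (auto simp: g_def inv_into_f_f[OF inj] subset_iff split: if_splits)
    then show "g -` A \<inter> space borel \<in> sets borel" using \<psi>_sets[OF A] range by auto
  qed
  define B where "B = {p \<in> space (borel \<Otimes>\<^sub>M borel). fst p \<in> \<psi> ` space M \<and> snd p \<in> \<psi> ` space M \<and> (g (fst p), g (snd p)) \<in> E}"
  have "B \<in> sets (borel \<Otimes>\<^sub>M borel)" unfolding B_def by measurable
  then have B: "B \<in> sets borel" by (simp only: borel_prod)
  have nbhd_sub: "nbhd E v \<subseteq> space M" for v using E_sub by auto
  have nbhd_B: "nbhd B (\<psi> v) = \<psi> ` nbhd E v" if "v \<in> space M" for v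
    using that nbhd_sub[of v] by (force simp: B_def space_pair_measure)
  have nbhd_B': "nbhd B a = {}" if "a \<notin> \<psi> ` space M" for a using that by (auto simp: B_def)
  have card_B: "card (nbhd B (\<psi> v)) = card (nbhd E v)" if "v \<in> space M" for v
    unfolding nbhd_B[OF that] by (intro card_image inj_on_subset[OF inj] nbhd_sub)
  have "finite (nbhd B a)" "card (nbhd B a) \<le> d" for a
    using nbhd_B nbhd_B' card_B d by (cases "a \<in> \<psi> ` space M"; force)+
  then obtain f where "measurable_enumeration borel B f"
    using measurable_enumeration_borel[OF B, of d] by blast
  then have f[measurable]: "f i \<in> borel_measurable borel"
    and f_card[measurable]: "(\<lambda>a. card (nbhd B a)) \<in> measurable borel (count_space UNIV)"
    and f_bij: "bij_betw (\<lambda>i. f i a) {..<card (nbhd B a)} (nbhd B a)" for i a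
    by (simp_all add: measurable_enumeration_def)
  have "measurable_enumeration M E (\<lambda>i v. g (f i (\<psi> v)))"
    unfolding measurable_enumeration_def
  proof (intro conjI allI ballI)
    show "(\<lambda>v. g (f i (\<psi> v))) \<in> measurable M M" for i by measurable
    have "(\<lambda>v. card (nbhd B (\<psi> v))) \<in> measurable M (count_space UNIV)" by measurable
    then show "(\<lambda>v. card (nbhd E v)) \<in> measurable M (count_space UNIV)"
      by (rule measurable_cong[THEN iffD1, rotated]) (simp add: card_B)
    fix v assume v: "v \<in> space M"
    have "bij_betw g (\<psi> ` nbhd E v) (nbhd E v)"
      using nbhd_sub[of v] by (intro bij_betwI[where g = \<psi>]) auto
    moreover have "bij_betw (\<lambda>i. f i (\<psi> v)) {..<card (nbhd E v)} (\<psi> ` nbhd E v)"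
      using f_bij[of "\<psi> v"] by (simp only: card_B[OF v] nbhd_B[OF v, symmetric])
    ultimately show "bij_betw (\<lambda>i. g (f i (\<psi> v))) {..<card (nbhd E v)} (nbhd E v)"
      using bij_betw_trans unfolding comp_def by blast
  qed
  then show ?thesis by blast
qed

text \<open>These keys serve twice: they let equality of directed edges be tested by real functions,
  and they break the symmetry between the two directions of a walk.\<close>

lemma standard_borel_pair_injection:
  assumes "standard_borel M"
  obtains J :: "'a \<times> 'a \<Rightarrow> real"
  where "J \<in> borel_measurable (M \<Otimes>\<^sub>M M)" "inj_on J (space M \<times> space M)" "\<And>e. 0 \<le> J e" "\<And>e. J e < 2"
proof -
  obtain \<psi> :: "'a \<Rightarrow> nat \<Rightarrow> real" where \<psi>[measurable]: "\<psi> \<in> borel_measurable M"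
    and inj: "inj_on \<psi> (space M)"
    using standard_borel_embedding[OF assms] by metis
  obtain j :: "(nat \<Rightarrow> real) \<times> (nat \<Rightarrow> real) \<Rightarrow> real"
    where j: "j \<in> borel_measurable borel" "inj j" "\<And>x. 0 \<le> j x" "\<And>x. j x < 2"
    using borel_injection_real by metis
  note j(1)[measurable]
  have "(\<lambda>e. j (\<psi> (fst e), \<psi> (snd e))) \<in> borel_measurable (M \<Otimes>\<^sub>M M)" by measurable
  moreover have "inj_on (\<lambda>e. j (\<psi> (fst e), \<psi> (snd e))) (space M \<times> space M)"
    using inj j(2) by (auto simp: inj_on_def)
  ultimately show ?thesis using that j(3,4) by blast
qed

section \<open>Orienting the walks of a pairing\<close>

text \<open>\<open>T\<close> sends \<open>(x, y)\<close> to \<open>(y, z)\<close>, where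
  \<open>z\<close> is the partner of \<open>x\<close> at \<open>y\<close>. \<open>T_swap_T\<close>
  makes partnership symmetric, so a reversed walk is again a walk; \<open>T_neq_swap\<close> says
  that no neighbour is its own partner.\<close>

locale paired_graph =
  fixes E :: "('a \<times> 'a) set" and T :: "'a \<times> 'a \<Rightarrow> 'a \<times> 'a" and J :: "'a \<times> 'a \<Rightarrow> real"
  assumes swap_E: "e \<in> E \<Longrightarrow> prod.swap e \<in> E"
    and swap_neq: "e \<in> E \<Longrightarrow> prod.swap e \<noteq> e"
    and T_E: "e \<in> E \<Longrightarrow> T e \<in> E"
    and fst_T: "e \<in> E \<Longrightarrow> fst (T e) = snd e"
    and T_swap_T: "e \<in> E \<Longrightarrow> T (prod.swap (T e)) = prod.swap e"
    and T_neq_swap: "e \<in> E \<Longrightarrow> T e \<noteq> prod.swap e"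
    and J_inj: "inj_on J E" and J_nonneg: "0 \<le> J e" and J_less: "J e < 2"
begin

lemma T_inj: "a \<in> E \<Longrightarrow> b \<in> E \<Longrightarrow> T a = T b \<Longrightarrow> a = b"
  by (metis T_swap_T swap_swap)

lemma Tpow_E: "e \<in> E \<Longrightarrow> (T ^^ k) e \<in> E"
  by (induction k) (auto intro: T_E)

lemma Tpow_inj: "a \<in> E \<Longrightarrow> b \<in> E \<Longrightarrow> (T ^^ k) a = (T ^^ k) b \<Longrightarrow> a = b"
  by (induction k) (auto dest: T_inj[OF Tpow_E Tpow_E])

text \<open>Peeling off the first and the last step of a segment from \<open>e\<close> to its reversal leaves such a segment
  that is shorter by two.\<close>

lemma Tpow_neq_swap: "e \<in> E \<Longrightarrow> (T ^^ k) e \<noteq> prod.swap e"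
proof (induction k arbitrary: e rule: less_induct)
  case (less k)
  consider "k = 0" | "k = 1" | m where "k = Suc (Suc m)" using not0_implies_Suc[of k] not0_implies_Suc[of "k - 1"] by force
  then show ?case
  proof cases
    case 3
    show ?thesis
    proof
      assume eq: "(T ^^ k) e = prod.swap e"
      have "(T ^^ k) e = T ((T ^^ m) (T e))" unfolding 3 funpow_swap1 by (simp add: funpow_swap1)
      then have "T ((T ^^ m) (T e)) = T (prod.swap (T e))"
        unfolding T_swap_T[OF less.prems] eq by (rule sym)
      then have "(T ^^ m) (T e) = prod.swap (T e)"
        by (rule T_inj[rotated 2]) (intro Tpow_E swap_E T_E less.prems)+
      then show False using less.IH[of m "T e"] T_E[OF less.prems] by (simp add: 3)
    qed
  qed (use swap_neq[OF less.prems] T_neq_swap[OF less.prems] in auto)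
qed

text \<open>Injectivity of the powers of \<open>T\<close> cancels the shorter orbit segment, leaving
  a walk from an edge to its own reversal.\<close>

lemma orbits_disjoint:
  assumes e: "e \<in> E"
  shows "(T ^^ k) e \<noteq> (T ^^ l) (prod.swap e)"
proof
  assume eq: "(T ^^ k) e = (T ^^ l) (prod.swap e)"
  have split: "(T ^^ n) x = (T ^^ m) ((T ^^ (n - m)) x)" if "m \<le> n" for m n x
    using funpow_add[of m "n - m" T] that by simp
  show False
  proof (cases "l \<le> k")
    case True
    then have "(T ^^ l) ((T ^^ (k - l)) e) = (T ^^ l) (prod.swap e)"
      using eq split[OF True, of e] by simp
    then have "(T ^^ (k - l)) e = prod.swap e" by (rule Tpow_inj[OF Tpow_E[OF e] swap_E[OF e]])
    then show False using Tpow_neq_swap[OF e] by blast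
  next
    case False
    then have "(T ^^ k) e = (T ^^ k) ((T ^^ (l - k)) (prod.swap e))"
      using eq split[of k l "prod.swap e"] by simp
    then have "e = (T ^^ (l - k)) (prod.swap e)" by (rule Tpow_inj[OF e Tpow_E[OF swap_E[OF e]]])
    then show False using Tpow_neq_swap[OF swap_E[OF e], of "l - k"] by simp
  qed
qed

section \<open>Tails of walks and cut edges\<close>

definition tail :: "'a \<times> 'a \<Rightarrow> ereal" where
  "tail e = liminf (\<lambda>k. ereal (J ((T ^^ k) e)))"

lemma tail_bounds: "0 \<le> tail e" "tail e \<le> 2"
proof -
  show "0 \<le> tail e" unfolding tail_def
    using J_nonneg by (intro Liminf_bounded) auto
  show "tail e \<le> 2" unfolding tail_def
    by (intro Liminf_le) (auto intro!: always_eventually less_imp_le[OF J_less])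
qed

lemma tail_T: "tail (T e) = tail e"
  using liminf_shift[of "\<lambda>k. ereal (J ((T ^^ k) e))"] by (simp add: tail_def funpow_swap1)

text \<open>The reversal of \<open>T e\<close> is mapped by \<open>T\<close> to the reversal of
  \<open>e\<close>, so the backward tail is constant along the walk too.\<close>

lemma tail_swap_T: "e \<in> E \<Longrightarrow> tail (prod.swap (T e)) = tail (prod.swap e)"
  by (metis tail_T T_swap_T)

lemma tail_Tpow: "e \<in> E \<Longrightarrow> tail ((T ^^ k) e) = tail e \<and> tail (prod.swap ((T ^^ k) e)) = tail (prod.swap e)"
  by (induction k) (auto simp: tail_T tail_swap_T Tpow_E)

text \<open>The keys eventually exceed the liminf minus \<open>\<epsilon>\<close>; if none came
  within \<open>\<epsilon>\<close>, they would eventually be at least the liminf plus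
  \<open>\<epsilon>\<close>.\<close>

lemma tail_approx:
  assumes "\<epsilon> > 0"
  shows "\<exists>k. \<bar>J ((T ^^ k) e) - real_of_ereal (tail e)\<bar> < \<epsilon>"
proof -
  obtain r where r: "tail e = ereal r" using tail_bounds[of e] by (cases "tail e") auto
  have "ereal (r - \<epsilon>) < tail e" using r assms by simp
  then have ev: "\<forall>\<^sub>F k in sequentially. ereal (r - \<epsilon>) < ereal (J ((T ^^ k) e))"
    unfolding tail_def by (rule less_LiminfD)
  show ?thesis
  proof (rule ccontr)
    assume "\<not> ?thesis"
    then have far: "\<epsilon> \<le> \<bar>J ((T ^^ k) e) - r\<bar>" for k using r by (simp add: not_less)
    from ev have "\<forall>\<^sub>F k in sequentially. ereal (r + \<epsilon>) \<le> ereal (J ((T ^^ k) e))"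
    proof eventually_elim
      case (elim k)
      then show ?case using far[of k] by (simp add: abs_if split: if_splits)
    qed
    then have "ereal (r + \<epsilon>) \<le> tail e"
      unfolding tail_def by (intro Liminf_bounded)
    then show False using r assms by simp
  qed
qed

text \<open>Excluding keys equal to the tail leaves a positive gap, so a fixed edge satisfies this
  for only finitely many \<open>n\<close>.\<close>

definition near_tail :: "nat \<Rightarrow> 'a \<times> 'a \<Rightarrow> bool" where
  "near_tail n e \<longleftrightarrow> J e \<noteq> real_of_ereal (tail e) \<and> \<bar>J e - real_of_ereal (tail e)\<bar> < inverse (real (Suc n))"

text \<open>The condition is symmetric under reversal, so that an undirected edge is cut.\<close>

definition cut :: "nat \<Rightarrow> ('a \<times> 'a) set" where
  "cut n = {e. e \<in> E \<and> tail e = tail (prod.swap e) \<and> (near_tail n e \<or> near_tail n (prod.swap e))}"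

lemma cut_swap: "e \<in> E \<Longrightarrow> prod.swap e \<in> cut n \<longleftrightarrow> e \<in> cut n"
  by (auto simp: cut_def swap_E)

lemma eventually_not_near_tail: "\<forall>\<^sub>F n in sequentially. \<not> near_tail n e"
proof (cases "J e = real_of_ereal (tail e)")
  case False
  then have "\<forall>\<^sub>F n in sequentially. inverse (real (Suc n)) < \<bar>J e - real_of_ereal (tail e)\<bar>"
    by (intro order_tendstoD(2)[OF LIMSEQ_inverse_real_of_nat]) simp
  then show ?thesis by eventually_elim (simp add: near_tail_def)
qed (simp add: near_tail_def)

lemma eventually_not_cut: "\<forall>\<^sub>F n in sequentially. e \<notin> cut n"
  using eventually_not_near_tail[of e] eventually_not_near_tail[of "prod.swap e"]
  by eventually_elim (simp add: cut_def)

text \<open>Each direction has an edge whose key is close to the common tail. The two keys differ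
  because the orbits are disjoint and \<open>J\<close> is injective, so at least one key is not the
  tail itself and its edge is a cut.\<close>

lemma cut_hit:
  assumes e: "e \<in> E" and eq: "tail e = tail (prod.swap e)"
  shows "\<exists>k. (T ^^ k) e \<in> cut n \<or> (T ^^ k) (prod.swap e) \<in> cut n"
proof -
  let ?d = "inverse (real (Suc n))"
  obtain k l where kl: "\<bar>J ((T ^^ k) e) - real_of_ereal (tail e)\<bar> < ?d"
    "\<bar>J ((T ^^ l) (prod.swap e)) - real_of_ereal (tail (prod.swap e))\<bar> < ?d"
    using tail_approx[of ?d e] tail_approx[of ?d "prod.swap e"] by auto
  have "J ((T ^^ k) e) \<noteq> J ((T ^^ l) (prod.swap e))"
    using orbits_disjoint[OF e] inj_onD[OF J_inj] Tpow_E e swap_E by metis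
  then consider "J ((T ^^ k) e) \<noteq> real_of_ereal (tail e)"
    | "J ((T ^^ l) (prod.swap e)) \<noteq> real_of_ereal (tail (prod.swap e))" using eq by metis
  then show ?thesis
  proof cases
    case 1
    then have "(T ^^ k) e \<in> cut n"
      using kl(1) tail_Tpow[OF e] eq by (simp add: cut_def near_tail_def Tpow_E e)
    then show ?thesis by blast
  next
    case 2
    then have "(T ^^ l) (prod.swap e) \<in> cut n"
      using kl(2) tail_Tpow[OF swap_E[OF e]] eq by (simp add: cut_def near_tail_def Tpow_E swap_E e)
    then show ?thesis by blast
  qed
qed

text \<open>The key of the first cut edge met when walking forward from \<open>e\<close>, with
  \<open>e\<close> itself included. The default 2 lies above all keys, so a direction without cuts
  loses the comparison.\<close>

definition hit :: "nat \<Rightarrow> 'a \<times> 'a \<Rightarrow> real" where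
  "hit n e = (if \<exists>k. (T ^^ k) e \<in> cut n then J ((T ^^ (LEAST k. (T ^^ k) e \<in> cut n)) e) else 2)"

lemma hit_T:
  assumes "e \<notin> cut n"
  shows "hit n (T e) = hit n e"
proof -
  have ex: "(\<exists>k. (T ^^ k) (T e) \<in> cut n) \<longleftrightarrow> (\<exists>k. (T ^^ k) e \<in> cut n)"
  proof
    assume "\<exists>k. (T ^^ k) e \<in> cut n"
    then obtain k where k: "(T ^^ k) e \<in> cut n" by blast
    then obtain m where "k = Suc m" using assms by (cases k) auto
    then show "\<exists>k. (T ^^ k) (T e) \<in> cut n" using k by (auto simp: funpow_swap1)
  qed (metis funpow_Suc_right comp_apply)
  show ?thesis
  proof (cases "\<exists>k. (T ^^ k) e \<in> cut n")
    case True
    then obtain k where "(T ^^ k) e \<in> cut n" by blast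
    then have "(LEAST k. (T ^^ k) e \<in> cut n) = Suc (LEAST k. (T ^^ Suc k) e \<in> cut n)"
      using assms by (intro Least_Suc[of _ k]) auto
    then show ?thesis using True ex by (simp add: hit_def funpow_swap1)
  qed (use ex in \<open>simp add: hit_def\<close>)
qed

text \<open>Unequal tails orient the whole walk at once; for equal tails the cuts break it into
  pieces, each oriented by the keys at its ends.\<close>

definition walk_orientation :: "nat \<Rightarrow> ('a \<times> 'a) set" where
  "walk_orientation n = {e. e \<in> E \<and> (tail e < tail (prod.swap e) \<or>
     tail e = tail (prod.swap e) \<and> hit n e < hit n (prod.swap e))}"

text \<open>Keys from the two directions are never equal, and \<open>cut_hit\<close> rules out that
  both values are the default.\<close>

lemma hit_neq:
  assumes e: "e \<in> E" and eq: "tail e = tail (prod.swap e)"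
  shows "hit n e \<noteq> hit n (prod.swap e)"
proof -
  have "J ((T ^^ k) e) \<noteq> J ((T ^^ l) (prod.swap e))" for k l
    using orbits_disjoint[OF e] inj_onD[OF J_inj] Tpow_E e swap_E by metis
  then show ?thesis using cut_hit[OF e eq, of n] J_less less_irrefl unfolding hit_def by metis
qed

lemma walk_orientation_swap:
  assumes "e \<in> E"
  shows "e \<in> walk_orientation n \<longleftrightarrow> prod.swap e \<notin> walk_orientation n"
proof (cases "tail e" "tail (prod.swap e)" rule: linorder_cases)
  case equal
  then show ?thesis
    using hit_neq[OF assms equal, of n] swap_E[OF assms] assms by (auto simp add: walk_orientation_def)
qed (use swap_E[OF assms] assms in \<open>auto simp: walk_orientation_def\<close>)

text \<open>Passing from \<open>e\<close> to \<open>T e\<close> crosses no cut in either direction,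
  so all quantities compared in the definition stay the same.\<close>

lemma walk_orientation_T:
  assumes "e \<in> E" "e \<notin> cut n" "T e \<notin> cut n"
  shows "T e \<in> walk_orientation n \<longleftrightarrow> e \<in> walk_orientation n"
proof -
  have "prod.swap (T e) \<notin> cut n" using assms cut_swap T_E by blast
  then have "hit n (prod.swap (T e)) = hit n (prod.swap e)"
    using hit_T[of "prod.swap (T e)" n] T_swap_T[OF assms(1)] by simp
  then show ?thesis
    using assms T_E by (simp add: walk_orientation_def tail_T tail_swap_T hit_T)
qed

text \<open>When no edge at \<open>v\<close> is cut, \<open>T\<close> matches incoming with outgoing
  edges; its inverse reverses, applies \<open>T\<close>, and reverses again.\<close>

lemma walk_orientation_balanced:
  assumes nbr: "\<And>u. (u, v) \<in> E \<Longrightarrow> (u, v) \<notin> cut n"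
  shows "card (in_edges (walk_orientation n) v) = card (out_edges (walk_orientation n) v)"
proof -
  let ?S = "walk_orientation n"
  have sub: "?S \<subseteq> E" by (auto simp: walk_orientation_def)
  have nbr': "e \<notin> cut n" if "e \<in> E" "snd e = v \<or> fst e = v" for e
    using that nbr cut_swap[of e n] swap_E[of e] by (cases e) auto
  have snd_swap: "snd (prod.swap (T (prod.swap e))) = fst e" if "e \<in> E" for e
    using fst_T[OF swap_E[OF that]] by simp
  have T_back: "T (prod.swap (T (prod.swap e))) = e" if "e \<in> E" for e
    using T_swap_T[OF swap_E[OF that]] by simp
  have "bij_betw T (in_edges ?S v) (out_edges ?S v)"
  proof (rule bij_betwI[where g = "\<lambda>e. prod.swap (T (prod.swap e))"])
    show "T \<in> in_edges ?S v \<rightarrow> out_edges ?S v"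
    proof
      fix e assume "e \<in> in_edges ?S v"
      then have e: "e \<in> ?S" "snd e = v" "e \<in> E" using sub by (auto simp: in_edges_def)
      then have "T e \<in> ?S" using walk_orientation_T[of e n] nbr' T_E fst_T by metis
      then show "T e \<in> out_edges ?S v" using fst_T e by (simp add: out_edges_def)
    qed
    show "(\<lambda>e. prod.swap (T (prod.swap e))) \<in> out_edges ?S v \<rightarrow> in_edges ?S v"
    proof
      fix e assume "e \<in> out_edges ?S v"
      then have e: "e \<in> ?S" "fst e = v" "e \<in> E" using sub by (auto simp: out_edges_def)
      let ?e = "prod.swap (T (prod.swap e))"
      have "?e \<in> E" using e by (intro swap_E T_E)
      moreover have "snd ?e = v" using snd_swap e by blast
      ultimately have "?e \<in> ?S" using walk_orientation_T[of ?e n] T_back nbr' e by metis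
      then show "?e \<in> in_edges ?S v" using \<open>snd ?e = v\<close> by (simp add: in_edges_def)
    qed
    show "prod.swap (T (prod.swap (T e))) = e" if "e \<in> in_edges ?S v" for e
      using that T_swap_T[OF subsetD[OF sub]] by (simp add: in_edges_def)
    show "T (prod.swap (T (prod.swap e))) = e" if "e \<in> out_edges ?S v" for e
      using that T_back[OF subsetD[OF sub]] by (simp add: out_edges_def)
  qed
  then show ?thesis by (rule bij_betw_same_card)
qed

end

section \<open>Even degree graphs\<close>

definition partner :: "nat \<Rightarrow> nat" where "partner i = (if even i then i + 1 else i - 1)"

lemma partner_partner [simp]: "partner (partner i) = i"
  and partner_neq [simp]: "partner i \<noteq> i"
  by (auto simp: partner_def elim: oddE)

text \<open>For odd \<open>n\<close> the last index would be paired with \<open>n\<close>; this is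
  how even degree enters the construction.\<close>

lemma partner_less: "even n \<Longrightarrow> i < n \<Longrightarrow> partner i < n"
  by (auto simp: partner_def elim!: evenE)

section \<open>Measurability of the balanced vertices\<close>

lemma card_edges_eq:
  assumes enum: "bij_betw (\<lambda>i. f i v) {..<c} (nbhd E v)" and sub: "S \<subseteq> E" "sym E"
  shows "card (out_edges S v) = card {i. i < c \<and> (v, f i v) \<in> S}"
    and "card (in_edges S v) = card {i. i < c \<and> (f i v, v) \<in> S}"
proof -
  have inj: "inj_on (\<lambda>i. f i v) {..<c}" and im: "(\<lambda>i. f i v) ` {..<c} = nbhd E v"
    using enum by (auto simp: bij_betw_def)
  have *: "\<exists>i<c. u = f i v" if "(v, u) \<in> E" for u
    using that im by (metis image_iff lessThan_iff nbhd_iff)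
  have "out_edges S v = (\<lambda>i. (v, f i v)) ` {i. i < c \<and> (v, f i v) \<in> S}"
    using * sub(1) by (fastforce simp: out_edges_def)
  moreover have "inj_on (\<lambda>i. (v, f i v)) {i. i < c \<and> (v, f i v) \<in> S}"
    using inj by (auto simp: inj_on_def)
  ultimately show "card (out_edges S v) = card {i. i < c \<and> (v, f i v) \<in> S}"
    by (simp add: card_image)
  have "in_edges S v = (\<lambda>i. (f i v, v)) ` {i. i < c \<and> (f i v, v) \<in> S}"
    using * sub symD[OF sub(2)] by (fastforce simp: in_edges_def)
  moreover have "inj_on (\<lambda>i. (f i v, v)) {i. i < c \<and> (f i v, v) \<in> S}"
    using inj by (auto simp: inj_on_def)
  ultimately show "card (in_edges S v) = card {i. i < c \<and> (f i v, v) \<in> S}"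
    by (simp add: card_image)
qed

text \<open>Through the enumeration, in-degree and out-degree become counts of indices, and each
  index condition is measurable in \<open>v\<close>.\<close>

lemma Corr_measurable:
  assumes f: "measurable_enumeration M E f" and "sym E" and S: "orientation M E S"
  shows "Corr M S \<in> sets M"
proof -
  have [measurable]: "f i \<in> measurable M M" "(\<lambda>v. card (nbhd E v)) \<in> measurable M (count_space UNIV)" for i
    using f unfolding measurable_enumeration_def by auto
  have [measurable]: "S \<in> sets (M \<Otimes>\<^sub>M M)" and "S \<subseteq> E" using S unfolding orientation_def by auto
  have "bij_betw (\<lambda>i. f i v) {..<card (nbhd E v)} (nbhd E v)" if "v \<in> space M" for v
    using f that unfolding measurable_enumeration_def by blast
  note card_edges = card_edges_eq[where f = f, OF this \<open>S \<subseteq> E\<close> \<open>sym E\<close>]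
  have "Corr M S = {v \<in> space M. card {i. i < card (nbhd E v) \<and> (f i v, v) \<in> S} =
      card {i. i < card (nbhd E v) \<and> (v, f i v) \<in> S}}"
    unfolding Corr_def by (rule Collect_cong, rule conj_cong) (simp_all only: card_edges)
  also have "\<dots> \<in> sets M"
  proof -
    have [measurable]: "(\<lambda>v. card {i. i < card (nbhd E v) \<and> (f i v, v) \<in> S}) \<in> measurable M (count_space UNIV)"
      by (rule measurable_card, unfold mem_Collect_eq) measurable
    have [measurable]: "(\<lambda>v. card {i. i < card (nbhd E v) \<and> (v, f i v) \<in> S}) \<in> measurable M (count_space UNIV)"
      by (rule measurable_card, unfold mem_Collect_eq) measurable
    have "{v \<in> space M. real (card {i. i < card (nbhd E v) \<and> (f i v, v) \<in> S}) =
        real (card {i. i < card (nbhd E v) \<and> (v, f i v) \<in> S})} \<in> sets M" by measurable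
    then show ?thesis unfolding of_nat_eq_iff .
  qed
  finally show ?thesis .
qed

lemma Corr_nbhd_measurable:
  assumes f: "measurable_enumeration M E f" and "sym E" and S: "orientation M E S"
  shows "{v \<in> Corr M S. nbhd E v \<subseteq> Corr M S} \<in> sets M"
proof -
  have [measurable]: "f i \<in> measurable M M" "(\<lambda>v. card (nbhd E v)) \<in> measurable M (count_space UNIV)" for i
    using f unfolding measurable_enumeration_def by auto
  note Corr_measurable[OF assms, measurable]
  have "nbhd E v = (\<lambda>i. f i v) ` {..<card (nbhd E v)}" if "v \<in> space M" for v
    using f that by (auto simp: measurable_enumeration_def bij_betw_def)
  then have "nbhd E v \<subseteq> Corr M S \<longleftrightarrow> (\<forall>i. i < card (nbhd E v) \<longrightarrow> f i v \<in> Corr M S)" if "v \<in> space M" for v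
    using that by (metis image_subset_iff lessThan_iff)
  then have "{v \<in> Corr M S. nbhd E v \<subseteq> Corr M S} =
      {v \<in> space M. v \<in> Corr M S \<and> (\<forall>i. i < card (nbhd E v) \<longrightarrow> f i v \<in> Corr M S)}"
    by (auto simp: Corr_def)
  also have "\<dots> \<in> sets M" by measurable
  finally show ?thesis .
qed

text \<open>At each \<open>y\<close> the neighbours of index \<open>2 * m\<close> and
  \<open>2 * m + 1\<close> are paired.\<close>

lemma even_degree_pairing:
  assumes f: "measurable_enumeration M E f" and E: "E \<subseteq> space M \<times> space M" "sym E" "irrefl E"
    and even: "\<forall>v\<in>space M. even (card (nbhd E v))"
    and J: "J \<in> borel_measurable (M \<Otimes>\<^sub>M M)" "inj_on J (space M \<times> space M)" "\<And>e. 0 \<le> J e" "\<And>e. J e < 2"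
  obtains T where "T \<in> measurable (M \<Otimes>\<^sub>M M) (M \<Otimes>\<^sub>M M)" "paired_graph E T J"
proof -
  note J(1)[measurable]
  have [measurable]: "f i \<in> measurable M M" for i
    using f unfolding measurable_enumeration_def by auto
  \<comment> \<open>The index of the source of \<open>e\<close> among the neighbours of its target.
    Comparing keys instead of vertices makes this an equality of measurable real functions.\<close>
  define idx where "idx e = (LEAST i. J (f i (snd e), snd e) = J e)" for e
  have J_f: "(\<lambda>e. J (f i (snd e), snd e)) \<in> borel_measurable (M \<Otimes>\<^sub>M M)" for i by measurable
  have "Measurable.pred (M \<Otimes>\<^sub>M M) (\<lambda>e. J (f i (snd e), snd e) = J e)" for i
    unfolding pred_def by (rule borel_measurable_eq[OF J_f J(1)])
  then have [measurable]: "idx \<in> measurable (M \<Otimes>\<^sub>M M) (count_space UNIV)"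
    unfolding idx_def by (rule measurable_Least)
  define T where "T e = (snd e, f (partner (idx e)) (snd e))" for e
  have T: "T \<in> measurable (M \<Otimes>\<^sub>M M) (M \<Otimes>\<^sub>M M)"
    unfolding T_def[abs_def]
  proof (rule measurable_Pair[OF measurable_snd])
    show "(\<lambda>e. f (partner (idx e)) (snd e)) \<in> measurable (M \<Otimes>\<^sub>M M) M"
      by (rule measurable_compose_countable[where f = "\<lambda>i e. f (partner i) (snd e)"]) measurable
  qed
  have idx: "idx (f i y, y) = i" if y: "y \<in> space M" and i: "i < card (nbhd E y)" for i y
  proof -
    have inj: "inj_on (\<lambda>i. f i y) {..<card (nbhd E y)}"
      using f y unfolding measurable_enumeration_def bij_betw_def by auto
    have "f k y \<in> space M" for k using f y unfolding measurable_enumeration_def by (meson measurable_space)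
    then have "J (f k y, y) = J (f i y, y) \<longleftrightarrow> f k y = f i y" for k
      using y inj_on_eq_iff[OF J(2), of "(f k y, y)" "(f i y, y)"] by simp
    then have "idx (f i y, y) = (LEAST k. f k y = f i y)" by (simp add: idx_def)
    \<comment> \<open>The enumeration is injective only below the degree, and larger indices may
      repeat a neighbour; the least index is the right one.\<close>
    also have "\<dots> = i"
    proof (rule Least_equality)
      fix k assume k: "f k y = f i y"
      show "i \<le> k"
      proof (rule ccontr)
        assume "\<not> i \<le> k"
        then show False using inj_onD[OF inj k] i by simp
      qed
    qed simp
    finally show ?thesis .
  qed
  have edge: "\<exists>i y. e = (f i y, y) \<and> y \<in> space M \<and> i < card (nbhd E y)" if "e \<in> E" for e
  proof -
    obtain x y where e: "e = (x, y)" by (cases e)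
    then have "y \<in> space M" "x \<in> nbhd E y" using that E by (auto dest: symD)
    moreover then obtain i where "i < card (nbhd E y)" "x = f i y"
      using f unfolding measurable_enumeration_def bij_betw_def by (metis image_iff lessThan_iff)
    ultimately show ?thesis using e by blast
  qed
  have T_eq: "T (f i y, y) = (y, f (partner i) y)" if "y \<in> space M" "i < card (nbhd E y)" for i y
    using idx[OF that] by (simp add: T_def)
  have in_E: "(y, f i y) \<in> E" if "y \<in> space M" "i < card (nbhd E y)" for i y
    using f that unfolding measurable_enumeration_def bij_betw_def by (metis imageI lessThan_iff nbhd_iff)
  have pl: "partner i < card (nbhd E y)" if "y \<in> space M" "i < card (nbhd E y)" for i y
    using that even by (intro partner_less) auto
  have "paired_graph E T J"
  proof
    show "prod.swap e \<in> E" if "e \<in> E" for e using that E(2) by (cases e) (auto dest: symD)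
    show "prod.swap e \<noteq> e" if "e \<in> E" for e using that E(3) by (cases e) (auto simp: irrefl_def)
    show "fst (T e) = snd e" for e by (simp add: T_def)
    show "T e \<in> E" if "e \<in> E" for e
      using edge[OF that] T_eq in_E pl by force
    show "T (prod.swap (T e)) = prod.swap e" if "e \<in> E" for e
      using edge[OF that] T_eq pl by force
    show "T e \<noteq> prod.swap e" if e: "e \<in> E" for e
    proof -
      obtain i y where iy: "e = (f i y, y)" "y \<in> space M" "i < card (nbhd E y)" using edge[OF e] by blast
      have "f (partner i) y \<noteq> f i y"
        using f iy pl[OF iy(2,3)] unfolding measurable_enumeration_def bij_betw_def
        by (metis inj_onD lessThan_iff partner_neq)
      then show ?thesis using T_eq[OF iy(2,3)] iy(1) by simp
    qed
    show "inj_on J E" using J(2) E(1) by (rule inj_on_subset)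
  qed (use J in auto)
  then show ?thesis using that T by blast
qed

lemma walk_orientation_measurable:
  assumes "paired_graph E T J" and [measurable]: "E \<in> sets (M \<Otimes>\<^sub>M M)" "J \<in> borel_measurable (M \<Otimes>\<^sub>M M)"
    and T[measurable]: "T \<in> measurable (M \<Otimes>\<^sub>M M) (M \<Otimes>\<^sub>M M)" and sub: "E \<subseteq> space M \<times> space M"
  shows "paired_graph.walk_orientation E T J n \<in> sets (M \<Otimes>\<^sub>M M)"
proof -
  interpret paired_graph E T J by fact
  have [measurable]: "prod.swap \<in> measurable (M \<Otimes>\<^sub>M M) (M \<Otimes>\<^sub>M M)"
    unfolding prod.swap_def by measurable
  have [measurable]: "(T ^^ k) \<in> measurable (M \<Otimes>\<^sub>M M) (M \<Otimes>\<^sub>M M)" for k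
    by (induction k) (auto intro: measurable_comp T simp: id_def)
  have [measurable]: "tail \<in> borel_measurable (M \<Otimes>\<^sub>M M)"
    unfolding tail_def[abs_def] by measurable
  have in_space: "E = {e \<in> space (M \<Otimes>\<^sub>M M). e \<in> E}" using sub by (auto simp: space_pair_measure)
  have "cut n = {e \<in> space (M \<Otimes>\<^sub>M M). e \<in> E \<and> tail e = tail (prod.swap e) \<and> (near_tail n e \<or> near_tail n (prod.swap e))}"
    using in_space by (auto simp: cut_def)
  also have "\<dots> \<in> sets (M \<Otimes>\<^sub>M M)" unfolding near_tail_def by measurable
  finally have [measurable]: "cut n \<in> sets (M \<Otimes>\<^sub>M M)" .
  \<comment> \<open>The exponent depends on \<open>e\<close> but takes only countably many
    values.\<close>
  have [measurable]: "(\<lambda>e. J ((T ^^ (LEAST k. (T ^^ k) e \<in> cut n)) e)) \<in> borel_measurable (M \<Otimes>\<^sub>M M)"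
    by (rule measurable_compose_countable[where f = "\<lambda>i e. J ((T ^^ i) e)"]) measurable
  have [measurable]: "hit n \<in> borel_measurable (M \<Otimes>\<^sub>M M)"
    unfolding hit_def[abs_def] by measurable
  have "walk_orientation n = {e \<in> space (M \<Otimes>\<^sub>M M). e \<in> E \<and> (tail e < tail (prod.swap e) \<or>
     tail e = tail (prod.swap e) \<and> hit n e < hit n (prod.swap e))}"
    using in_space by (auto simp: walk_orientation_def)
  also have "\<dots> \<in> sets (M \<Otimes>\<^sub>M M)" by measurable
  finally show ?thesis .
qed

section \<open>Passage to measures and the two implications\<close>

lemma (in prob_space) prob_tendsto_1:
  assumes "\<And>n. C n \<in> sets M" and ev: "\<And>v. v \<in> space M \<Longrightarrow> \<forall>\<^sub>F n in sequentially. v \<in> C n"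
  shows "(\<lambda>n. prob (C n)) \<longlonglongrightarrow> 1"
proof -
  have "(\<lambda>n. \<integral>v. indicator (C n) v \<partial>M) \<longlonglongrightarrow> (\<integral>v. (1::real) \<partial>M)"
  proof (rule integral_dominated_convergence[where w = "\<lambda>_. 1"])
    show "AE v in M. (\<lambda>n. indicator (C n) v :: real) \<longlonglongrightarrow> 1"
    proof (rule AE_I2)
      fix v assume "v \<in> space M"
      show "(\<lambda>n. indicator (C n) v :: real) \<longlonglongrightarrow> 1"
        by (rule tendsto_eventually, rule eventually_mono[OF ev[OF \<open>v \<in> space M\<close>]]) simp
    qed
  qed (use assms(1) in \<open>auto split: split_indicator\<close>)
  moreover have "C n \<inter> space M = C n" for n using sets.sets_into_space[OF assms(1)] by blast
  ultimately show ?thesis by (simp add: prob_space)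
qed

text \<open>Only finitely many edges meet a vertex or its neighbours, and each is cut for finitely
  many \<open>n\<close>. The convergence holds at every vertex, so one sequence serves all
  measures.\<close>

lemma even_degree_imp_orientations:
  assumes graph: "borel_graph M E" "bounded_degree M E" and even: "\<forall>v\<in>space M. even (card (nbhd E v))"
  shows "\<exists>S. (\<forall>n. orientation M E (S n)) \<and>
    (\<forall>n. {v \<in> Corr M (S n). nbhd E v \<subseteq> Corr M (S n)} \<in> sets M) \<and>
    (\<forall>v\<in>space M. \<forall>\<^sub>F n in sequentially. v \<in> Corr M (S n) \<and> nbhd E v \<subseteq> Corr M (S n))"
proof -
  have E: "E \<in> sets (M \<Otimes>\<^sub>M M)" "E \<subseteq> space M \<times> space M" "sym E" "irrefl E" "standard_borel M"
    using graph(1) unfolding borel_graph_def by auto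
  obtain f where f: "measurable_enumeration M E f" using exists_measurable_enumeration[OF graph] ..
  obtain J :: "'a \<times> 'a \<Rightarrow> real" where J: "J \<in> borel_measurable (M \<Otimes>\<^sub>M M)" "inj_on J (space M \<times> space M)"
    "\<And>e. 0 \<le> J e" "\<And>e. J e < 2" using standard_borel_pair_injection[OF E(5)] by metis
  obtain T where T: "T \<in> measurable (M \<Otimes>\<^sub>M M) (M \<Otimes>\<^sub>M M)" and "paired_graph E T J"
    using even_degree_pairing[OF f E(2-4) even J] by metis
  interpret paired_graph E T J by fact
  have orient: "orientation M E (walk_orientation n)" for n
    unfolding orientation_def
  proof (intro conjI allI impI)
    show "walk_orientation n \<in> sets (M \<Otimes>\<^sub>M M)"
      using walk_orientation_measurable[OF \<open>paired_graph E T J\<close> E(1) J(1) T E(2)] .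
    show "walk_orientation n \<subseteq> E" by (auto simp: walk_orientation_def)
    show "(x, y) \<in> walk_orientation n \<longleftrightarrow> (y, x) \<notin> walk_orientation n" if "(x, y) \<in> E" for x y
      using walk_orientation_swap[OF that, of n] by simp
  qed
  have fin: "finite (nbhd E v)" if "v \<in> space M" for v
    using graph(2) that unfolding bounded_degree_def by blast
  have ev_Corr: "\<forall>\<^sub>F n in sequentially. v \<in> Corr M (walk_orientation n)" if v: "v \<in> space M" for v
  proof -
    have "\<forall>\<^sub>F n in sequentially. \<forall>u\<in>nbhd E v. (u, v) \<notin> cut n"
      using fin[OF v] eventually_not_cut by (simp add: eventually_ball_finite_distrib)
    then show ?thesis
    proof eventually_elim
      case (elim n)
      then have "(u, v) \<notin> cut n" if "(u, v) \<in> E" for u using that E(3) by (auto dest: symD)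
      then show ?case using walk_orientation_balanced v by (auto simp: Corr_def)
    qed
  qed
  show ?thesis
  proof (intro exI[of _ walk_orientation] conjI allI ballI)
    show "{v \<in> Corr M (walk_orientation n). nbhd E v \<subseteq> Corr M (walk_orientation n)} \<in> sets M" for n
      by (rule Corr_nbhd_measurable[OF f E(3) orient])
    fix v assume v: "v \<in> space M"
    have "nbhd E v \<subseteq> space M" using E(2) by auto
    then have "\<forall>\<^sub>F n in sequentially. \<forall>u\<in>nbhd E v. u \<in> Corr M (walk_orientation n)"
      using fin[OF v] ev_Corr by (simp add: eventually_ball_finite_distrib subset_iff)
    with ev_Corr[OF v]
    show "\<forall>\<^sub>F n in sequentially. v \<in> Corr M (walk_orientation n) \<and> nbhd E v \<subseteq> Corr M (walk_orientation n)"
      by eventually_elim blast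
  qed (rule orient)
qed

text \<open>Under the Dirac measure at \<open>v\<close>, a set of measure above 1/2 contains
  \<open>v\<close>. Balance at \<open>v\<close> makes the degree twice the out-degree.\<close>

lemma approx_balanced_imp_even_degree:
  assumes graph: "borel_graph M E" "bounded_degree M E" and "approx_balanced_orientation M E" and v: "v \<in> space M"
  shows "even (card (nbhd E v))"
proof -
  interpret prob_space "return M v" using v by (rule prob_space_return)
  obtain S where S: "orientation M E S" and pos: "measure (return M v) (Corr M S) > 1 - 1/2"
    using assms(3) prob_space_axioms unfolding approx_balanced_orientation_def
    by (metis sets_return zero_less_one half_gt_zero)
  \<comment> \<open>Sets that are not measurable get measure 0, so the positive value implies
    measurability.\<close>
  then have "Corr M S \<in> sets M"
    using measure_notin_sets[of "Corr M S" "return M v"] by (cases "Corr M S \<in> sets M") auto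
  then have bal: "card (in_edges S v) = card (out_edges S v)"
    using pos by (auto simp: measure_return Corr_def split: split_indicator_asm)
  have SE: "S \<subseteq> E" and alt: "\<And>x y. (x, y) \<in> E \<Longrightarrow> (x, y) \<in> S \<longleftrightarrow> (y, x) \<notin> S" and "sym E"
    using S graph(1) unfolding orientation_def borel_graph_def by auto
  \<comment> \<open>In-edges are described by the complementary condition on \<open>(v, u)\<close>,
    so that in- and out-edges split the neighbourhood of \<open>v\<close>.\<close>
  have flip: "(u, v) \<in> S \<longleftrightarrow> (v, u) \<in> E \<and> (v, u) \<notin> S" for u
    using SE alt[of v u] symD[OF \<open>sym E\<close>, of u v] by blast
  have out: "out_edges S v = Pair v ` {u \<in> nbhd E v. (v, u) \<in> S}"
    using SE by (fastforce simp: out_edges_def)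
  have inn: "in_edges S v = (\<lambda>u. (u, v)) ` {u \<in> nbhd E v. (v, u) \<notin> S}"
    using flip by (fastforce simp: in_edges_def)
  have fin: "finite (nbhd E v)" using graph(2) v unfolding bounded_degree_def by blast
  have "card (nbhd E v) = card {u \<in> nbhd E v. (v, u) \<in> S} + card {u \<in> nbhd E v. (v, u) \<notin> S}"
  proof (subst card_Un_disjoint[symmetric])
    show "finite {u \<in> nbhd E v. (v, u) \<in> S}" "finite {u \<in> nbhd E v. (v, u) \<notin> S}"
      using fin by (rule finite_subset[rotated], blast)+
  qed (auto intro: arg_cong[of _ _ card])
  also have "card {u \<in> nbhd E v. (v, u) \<in> S} = card (out_edges S v)"
    unfolding out by (simp add: card_image inj_on_def)
  also have "card {u \<in> nbhd E v. (v, u) \<notin> S} = card (in_edges S v)"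
    unfolding inn by (simp add: card_image inj_on_def)
  finally show ?thesis using bal by simp
qed

theorem theorem1:
  fixes M :: "'a measure" and E :: "('a \<times> 'a) set"
  assumes "borel_graph M E" and "bounded_degree M E"
  shows "((\<forall>v\<in>space M. even (card (nbhd E v))) \<longleftrightarrow> approx_balanced_orientation M E) \<and>
         ((\<forall>v\<in>space M. even (card (nbhd E v))) \<longrightarrow>
            (\<exists>S :: nat \<Rightarrow> ('a \<times> 'a) set. (\<forall>n. orientation M E (S n)) \<and>
               (\<forall>\<mu> :: 'a measure. prob_space \<mu> \<and> sets \<mu> = sets M \<longrightarrow>
                  (\<lambda>n. measure \<mu> {v \<in> Corr M (S n). nbhd E v \<subseteq> Corr M (S n)})
                    \<longlonglongrightarrow> 1)))"
proof -
  have orientations: "\<exists>S. (\<forall>n. orientation M E (S n)) \<and>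
      (\<forall>\<mu>. prob_space \<mu> \<and> sets \<mu> = sets M \<longrightarrow>
         (\<lambda>n. measure \<mu> {v \<in> Corr M (S n). nbhd E v \<subseteq> Corr M (S n)}) \<longlonglongrightarrow> 1)"
    if even: "\<forall>v\<in>space M. even (card (nbhd E v))"
  proof -
    obtain S where S: "\<And>n. orientation M E (S n)"
      "\<And>n. {v \<in> Corr M (S n). nbhd E v \<subseteq> Corr M (S n)} \<in> sets M"
      "\<And>v. v \<in> space M \<Longrightarrow> \<forall>\<^sub>F n in sequentially. v \<in> Corr M (S n) \<and> nbhd E v \<subseteq> Corr M (S n)"
      using even_degree_imp_orientations[OF assms even] by blast
    have "(\<lambda>n. measure \<mu> {v \<in> Corr M (S n). nbhd E v \<subseteq> Corr M (S n)}) \<longlonglongrightarrow> 1"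
      if "prob_space \<mu>" and \<mu>: "sets \<mu> = sets M" for \<mu> :: "'a measure"
    proof -
      interpret prob_space \<mu> by fact
      show ?thesis
        using S(2,3) by (intro prob_tendsto_1) (auto simp: \<mu> sets_eq_imp_space_eq[OF \<mu>])
    qed
    then show ?thesis using S(1) by blast
  qed
  have "approx_balanced_orientation M E" if even: "\<forall>v\<in>space M. even (card (nbhd E v))"
    unfolding approx_balanced_orientation_def
  proof (intro allI impI)
    fix \<mu> :: "'a measure" and \<epsilon> :: real
    assume \<mu>: "prob_space \<mu> \<and> sets \<mu> = sets M" and "\<epsilon> > 0"
    then interpret prob_space \<mu> by blast
    obtain S where S: "\<And>n. orientation M E (S n)"
      and lim: "(\<lambda>n. prob {v \<in> Corr M (S n). nbhd E v \<subseteq> Corr M (S n)}) \<longlonglongrightarrow> 1"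
      using orientations[OF even] \<mu> by blast
    have "\<forall>\<^sub>F n in sequentially. 1 - \<epsilon> < prob {v \<in> Corr M (S n). nbhd E v \<subseteq> Corr M (S n)}"
      using \<open>\<epsilon> > 0\<close> by (intro order_tendstoD(1)[OF lim]) simp
    then obtain n where n: "1 - \<epsilon> < prob {v \<in> Corr M (S n). nbhd E v \<subseteq> Corr M (S n)}"
      using eventually_happens'[OF sequentially_bot] by blast
    \<comment> \<open>An enumeration makes \<open>Corr M (S n)\<close> measurable, as monotonicity
      of the measure requires.\<close>
    obtain f where "measurable_enumeration M E f" using exists_measurable_enumeration[OF assms] ..
    then have "Corr M (S n) \<in> sets \<mu>"
      using Corr_measurable S assms(1) \<mu> unfolding borel_graph_def by metis
    then have "prob {v \<in> Corr M (S n). nbhd E v \<subseteq> Corr M (S n)} \<le> prob (Corr M (S n))"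
      by (intro finite_measure_mono) auto
    then show "\<exists>S. orientation M E S \<and> prob (Corr M S) > 1 - \<epsilon>"
      using n S[of n] by (intro exI[of _ "S n"]) auto
  qed
  then show ?thesis using approx_balanced_imp_even_degree[OF assms] orientations by blast
qed

end
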